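(* The contravariant functors $\mathcal{P}$ and $\mathrm{at}$ restrict to a dual adjunction, with units $\varepsilon$ and $\eta$, between the category $\mathbf{StLCSob}$ of stably locally compact spaces and proper maps and the category $\mathbf{StLCMT}$ of stably locally compact MT-algebras and proper MT-morphisms. Moreover, they restrict to a dual equivalence between $\mathbf{StLCSob}$ and the full subcategory $\mathbf{StLCSMT}$ of $\mathbf{StLCMT}$ consisting of the spatial algebras.
   Context: An MT-algebra is a pair $M=(B,\square)$ where $B$ is a complete boolean algebra and $\square:B\to B$ satisfies $\square 1=1$, $\square(a\wedge b)=\square a\wedge\square b$, $\square a\le a$, $\square a\le\square\square a$. An MT-morphism $f:M\to N$ is a complete boolean homomorphism with $f(\square_M a)\le\square_N f(a)$ for all $a$. Put $\diamond a=\neg\square\neg a$. An element $a$ is open if $a=\square a$ and closed if $a=\diamond a$; $\mathrm{O}(M)$ and $\mathrm{C}(M)$ are the sets of open and closed elements. An element is saturated if it is a meet of open elements, and weakly locally closed if it is the meet of a saturated element and a closed element. $M$ is a $T_0$-algebra if every element is a join of weakly locally closed elements. $M$ is sober if it is a $T_0$-algebra and each join-irreducible (nonzero) element $p$ of $\mathrm{C}(M)$ is of the form $p=\diamond x$ for an atom $x$ of $M$. $M$ is spatial if $B$ is atomic. An element $a$ is compact if for each $S\subseteq\mathrm{O}(M)$ with $a\le\bigvee S$ there is a finite $T\subseteq S$ with $a\le\bigvee T$; $\mathrm{KS}(M)$ is the set of compact saturated elements. For $a,b\in M$ write $a\vartriangleleft b$ if there is a compact $k$ with $a\le k\le b$.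 $M$ is locally compact if $u=\bigvee\{v\in\mathrm{O}(M)\mid v\vartriangleleft u\}$ for all $u\in\mathrm{O}(M)$. $M$ is stably locally compact if it is locally compact, sober, and $k,m\in\mathrm{KS}(M)$ implies $k\wedge m\in\mathrm{KS}(M)$. An MT-morphism $f:M\to N$ between locally compact sober MT-algebras is proper if $a\in\mathrm{KS}(M)$ implies $f(a)\in\mathrm{KS}(N)$. A space is stably locally compact if it is sober, locally compact (for each open $U$ and $x\in U$ there are an open $V$ and a compact $K$ with $x\in V\subseteq K\subseteq U$), and the intersection of any two compact saturated sets is compact (saturated = intersection of open sets). A continuous map $f:X\to Y$ between locally compact sober spaces is proper if $f^{-1}(K)$ is compact for each compact saturated $K\subseteq Y$. Functors: $\mathcal{P}$ sends a space $X$ to $(\mathcal{P}(X),\mathrm{int})$ (the powerset with the interior operator) and a map $f$ to $f^{-1}$. $\mathrm{at}$ sends $M$ to its set of atoms $\mathrm{at}(M)$ with topology $\{\eta(a)\mid a\in\mathrm{O}(M)\}$, where $\eta(a)=\{x\in\mathrm{at}(M)\mid x\le a\}$, and an MT-morphism $f:M\to N$ to $\mathrm{at}(f):\mathrm{at}(N)\to\mathrm{at}(M)$, the restriction to atoms of the left adjoint $f^*(x)=\bigwedge\{a\in M\mid x\le f(a)\}$. The units are $\eta_M:M\to\mathcal{P}(\mathrm{at}(M))$ and $\varepsilon_X:X\to\mathrm{at}(\mathcal{P}(X))$, $\varepsilon_X(x)=\{x\}$. *)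

theory Defs
  imports "HOL-Analysis.Analysis" "HOL-Algebra.Complete_Lattice"
begin

section \<open>MT-algebras\<close>

text \<open>Algebras are carrier-based, on top of the order-theoretic records of HOL-Algebra: the
  powerset of a space is an algebra whose carrier need not exhaust a type.  For the same reason
  spaces are \<^typ>\<open>'a topology\<close> with an explicit \<^const>\<open>topspace\<close>.\<close>

record 'a mt = "'a gorder" +
  box :: "'a \<Rightarrow> 'a" (\<open>\<box>\<index> _\<close> [80] 80)

definition compl :: "('a, 'z) gorder_scheme \<Rightarrow> 'a \<Rightarrow> 'a" (\<open>\<sim>\<index> _\<close> [80] 80) where
  "\<sim>\<^bsub>L\<^esub> a = (THE b. b \<in> carrier L \<and> a \<sqinter>\<^bsub>L\<^esub> b = \<bottom>\<^bsub>L\<^esub> \<and> a \<squnion>\<^bsub>L\<^esub> b = \<top>\<^bsub>L\<^esub>)"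

text \<open>The one-element algebra is allowed; it is the powerset of the empty space.\<close>

locale complete_boolean_lattice = complete_lattice L for L (structure) +
  assumes meet_join_distrib:
    "\<lbrakk>x \<in> carrier L; y \<in> carrier L; z \<in> carrier L\<rbrakk> \<Longrightarrow> x \<sqinter> (y \<squnion> z) = (x \<sqinter> y) \<squnion> (x \<sqinter> z)"
    and complement_exists:
    "x \<in> carrier L \<Longrightarrow> \<exists>y\<in>carrier L. x \<sqinter> y = \<bottom> \<and> x \<squnion> y = \<top>"

locale mt_algebra = complete_boolean_lattice M for M (structure) +
  assumes box_closed: "a \<in> carrier M \<Longrightarrow> \<box> a \<in> carrier M"
    and box_top: "\<box> \<top> = \<top>"
    and box_meet: "\<lbrakk>a \<in> carrier M; b \<in> carrier M\<rbrakk> \<Longrightarrow> \<box> (a \<sqinter> b) = \<box> a \<sqinter> \<box> b"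
    and box_le: "a \<in> carrier M \<Longrightarrow> \<box> a \<sqsubseteq> a"
    and box_box: "a \<in> carrier M \<Longrightarrow> \<box> a \<sqsubseteq> \<box> \<box> a"

definition dia :: "('a, 'z) mt_scheme \<Rightarrow> 'a \<Rightarrow> 'a" (\<open>\<diamond>\<index> _\<close> [80] 80) where
  "\<diamond>\<^bsub>M\<^esub> a = \<sim>\<^bsub>M\<^esub> (\<box>\<^bsub>M\<^esub> (\<sim>\<^bsub>M\<^esub> a))"

definition opens :: "('a, 'z) mt_scheme \<Rightarrow> 'a set" where
  "opens M = {a \<in> carrier M. a = \<box>\<^bsub>M\<^esub> a}"

definition closeds :: "('a, 'z) mt_scheme \<Rightarrow> 'a set" where
  "closeds M = {a \<in> carrier M. a = \<diamond>\<^bsub>M\<^esub> a}"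

definition saturateds :: "('a, 'z) mt_scheme \<Rightarrow> 'a set" where
  "saturateds M = {\<Sqinter>\<^bsub>M\<^esub> S | S. S \<subseteq> opens M}"

definition weakly_locally_closeds :: "('a, 'z) mt_scheme \<Rightarrow> 'a set" where
  "weakly_locally_closeds M = {s \<sqinter>\<^bsub>M\<^esub> c | s c. s \<in> saturateds M \<and> c \<in> closeds M}"

definition T0_algebra :: "('a, 'z) mt_scheme \<Rightarrow> bool" where
  "T0_algebra M \<longleftrightarrow>
     mt_algebra M \<and> (\<forall>a\<in>carrier M. \<exists>S\<subseteq>weakly_locally_closeds M. a = \<Squnion>\<^bsub>M\<^esub> S)"

definition atoms :: "('a, 'z) gorder_scheme \<Rightarrow> 'a set" where
  "atoms L = {x \<in> carrier L. x \<noteq> \<bottom>\<^bsub>L\<^esub> \<and>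
     (\<forall>y\<in>carrier L. y \<sqsubseteq>\<^bsub>L\<^esub> x \<longrightarrow> y = \<bottom>\<^bsub>L\<^esub> \<or> y = x)}"

text \<open>Closed elements are stable under finite joins, so joins in the lattice of closed elements
  are the joins of the algebra.\<close>

definition join_irreducible_closeds :: "('a, 'z) mt_scheme \<Rightarrow> 'a set" where
  "join_irreducible_closeds M = {p \<in> closeds M. p \<noteq> \<bottom>\<^bsub>M\<^esub> \<and>
     (\<forall>a\<in>closeds M. \<forall>b\<in>closeds M. p = a \<squnion>\<^bsub>M\<^esub> b \<longrightarrow> p = a \<or> p = b)}"

definition sober_mt :: "('a, 'z) mt_scheme \<Rightarrow> bool" where
  "sober_mt M \<longleftrightarrow>
     T0_algebra M \<and> (\<forall>p\<in>join_irreducible_closeds M. \<exists>x\<in>atoms M. p = \<diamond>\<^bsub>M\<^esub> x)"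

definition spatial :: "('a, 'z) mt_scheme \<Rightarrow> bool" where
  "spatial M \<longleftrightarrow>
     mt_algebra M \<and> (\<forall>a\<in>carrier M. a \<noteq> \<bottom>\<^bsub>M\<^esub> \<longrightarrow> (\<exists>x\<in>atoms M. x \<sqsubseteq>\<^bsub>M\<^esub> a))"

definition compacts :: "('a, 'z) mt_scheme \<Rightarrow> 'a set" where
  "compacts M = {a \<in> carrier M. \<forall>S\<subseteq>opens M. a \<sqsubseteq>\<^bsub>M\<^esub> \<Squnion>\<^bsub>M\<^esub> S \<longrightarrow>
     (\<exists>T\<subseteq>S. finite T \<and> a \<sqsubseteq>\<^bsub>M\<^esub> \<Squnion>\<^bsub>M\<^esub> T)}"

definition KS :: "('a, 'z) mt_scheme \<Rightarrow> 'a set" where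
  "KS M = compacts M \<inter> saturateds M"

definition compactly_below :: "('a, 'z) mt_scheme \<Rightarrow> 'a \<Rightarrow> 'a \<Rightarrow> bool"  (infix \<open>\<lhd>\<index>\<close> 50) where
  "a \<lhd>\<^bsub>M\<^esub> b \<longleftrightarrow> (\<exists>k\<in>compacts M. a \<sqsubseteq>\<^bsub>M\<^esub> k \<and> k \<sqsubseteq>\<^bsub>M\<^esub> b)"

definition locally_compact_mt :: "('a, 'z) mt_scheme \<Rightarrow> bool" where
  "locally_compact_mt M \<longleftrightarrow>
     mt_algebra M \<and> (\<forall>u\<in>opens M. u = \<Squnion>\<^bsub>M\<^esub> {v \<in> opens M. v \<lhd>\<^bsub>M\<^esub> u})"

definition stably_locally_compact_mt :: "('a, 'z) mt_scheme \<Rightarrow> bool" where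
  "stably_locally_compact_mt M \<longleftrightarrow>
     locally_compact_mt M \<and> sober_mt M \<and> (\<forall>k\<in>KS M. \<forall>m\<in>KS M. k \<sqinter>\<^bsub>M\<^esub> m \<in> KS M)"

text \<open>Morphisms are extensional functions (\<^const>\<open>undefined\<close> off the carrier), so that two of them
  are equal exactly when they agree on the carrier.\<close>

definition complete_boolean_homs ::
    "('a, 'y) gorder_scheme \<Rightarrow> ('b, 'z) gorder_scheme \<Rightarrow> ('a \<Rightarrow> 'b) set" where
  "complete_boolean_homs L K = {f \<in> carrier L \<rightarrow>\<^sub>E carrier K.
     (\<forall>S\<subseteq>carrier L. f (\<Squnion>\<^bsub>L\<^esub> S) = \<Squnion>\<^bsub>K\<^esub> (f ` S) \<and> f (\<Sqinter>\<^bsub>L\<^esub> S) = \<Sqinter>\<^bsub>K\<^esub> (f ` S)) \<and>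
     (\<forall>a\<in>carrier L. f (\<sim>\<^bsub>L\<^esub> a) = \<sim>\<^bsub>K\<^esub> (f a))}"

definition mt_morphisms :: "('a, 'y) mt_scheme \<Rightarrow> ('b, 'z) mt_scheme \<Rightarrow> ('a \<Rightarrow> 'b) set" where
  "mt_morphisms M N = {f \<in> complete_boolean_homs M N.
     \<forall>a\<in>carrier M. f (\<box>\<^bsub>M\<^esub> a) \<sqsubseteq>\<^bsub>N\<^esub> \<box>\<^bsub>N\<^esub> (f a)}"

definition proper_mt_morphisms :: "('a, 'y) mt_scheme \<Rightarrow> ('b, 'z) mt_scheme \<Rightarrow> ('a \<Rightarrow> 'b) set" where
  "proper_mt_morphisms M N = {f \<in> mt_morphisms M N. \<forall>a\<in>KS M. f a \<in> KS N}"


section \<open>Spaces\<close>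

definition irreducible_closedin :: "'a topology \<Rightarrow> 'a set \<Rightarrow> bool" where
  "irreducible_closedin X C \<longleftrightarrow> closedin X C \<and> C \<noteq> {} \<and>
     (\<forall>A B. closedin X A \<and> closedin X B \<and> C = A \<union> B \<longrightarrow> C = A \<or> C = B)"

text \<open>Uniqueness of the generic point makes sober spaces \<open>T\<^sub>0\<close>.\<close>

definition sober_space :: "'a topology \<Rightarrow> bool" where
  "sober_space X \<longleftrightarrow>
     (\<forall>C. irreducible_closedin X C \<longrightarrow> (\<exists>!x. x \<in> topspace X \<and> C = X closure_of {x}))"

text \<open>The intersection with \<^term>\<open>topspace X\<close> only matters for the empty family.\<close>

definition saturatedin :: "'a topology \<Rightarrow> 'a set \<Rightarrow> bool" where
  "saturatedin X A \<longleftrightarrow> (\<exists>\<U>. (\<forall>U\<in>\<U>. openin X U) \<and> A = topspace X \<inter> \<Inter>\<U>)"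

text \<open>\<^term>\<open>neighbourhood_base_of (compactin X) X\<close> says that every point has arbitrarily small
  compact neighbourhoods; \<^const>\<open>locally_compact_space\<close> is weaker for non-Hausdorff spaces.\<close>

definition stably_locally_compact_space :: "'a topology \<Rightarrow> bool" where
  "stably_locally_compact_space X \<longleftrightarrow>
     sober_space X \<and> neighbourhood_base_of (compactin X) X \<and>
     (\<forall>K L. compactin X K \<and> saturatedin X K \<and> compactin X L \<and> saturatedin X L
        \<longrightarrow> compactin X (K \<inter> L))"

text \<open>This notion of properness differs from \<^const>\<open>proper_map\<close>, which asks for closed maps with
  compact fibres.\<close>

definition proper_maps :: "'a topology \<Rightarrow> 'b topology \<Rightarrow> ('a \<Rightarrow> 'b) set" where
  "proper_maps X Y = {f \<in> topspace X \<rightarrow>\<^sub>E topspace Y. continuous_map X Y f \<and>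
     (\<forall>K. compactin Y K \<and> saturatedin Y K \<longrightarrow> compactin X {x \<in> topspace X. f x \<in> K})}"


section \<open>The categories\<close>

text \<open>Hom-sets are \<^const>\<open>proper_maps\<close> and \<^const>\<open>proper_mt_morphisms\<close>; \<open>StLCSMT\<close> is a full
  subcategory and has the hom-sets of \<open>StLCMT\<close>.  The composite of \<open>f\<close> and \<open>g\<close> is
  \<^term>\<open>compose A g f\<close>, where \<open>A\<close> is the underlying set of the domain of \<open>f\<close>, and the identity is
  the restriction of \<^term>\<open>\<lambda>x. x\<close> to the underlying set.  All notions are polymorphic in the types
  of points or elements, and morphisms may connect objects over different types.\<close>

definition StLCSob :: "'a topology set" where
  "StLCSob = {X. stably_locally_compact_space X}"

definition StLCMT :: "'a mt set" where
  "StLCMT = {M. stably_locally_compact_mt M}"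

definition StLCSMT :: "'a mt set" where
  "StLCSMT = {M \<in> StLCMT. spatial M}"

definition space_id :: "'a topology \<Rightarrow> 'a \<Rightarrow> 'a" where
  "space_id X = (\<lambda>x\<in>topspace X. x)"

definition mt_id :: "('a, 'z) mt_scheme \<Rightarrow> 'a \<Rightarrow> 'a" where
  "mt_id M = (\<lambda>a\<in>carrier M. a)"

definition space_iso :: "'a topology \<Rightarrow> 'b topology \<Rightarrow> ('a \<Rightarrow> 'b) \<Rightarrow> bool" where
  "space_iso X Y f \<longleftrightarrow> f \<in> proper_maps X Y \<and>
     (\<exists>g\<in>proper_maps Y X. compose (topspace X) g f = space_id X \<and>
                           compose (topspace Y) f g = space_id Y)"

definition mt_iso :: "('a, 'y) mt_scheme \<Rightarrow> ('b, 'z) mt_scheme \<Rightarrow> ('a \<Rightarrow> 'b) \<Rightarrow> bool" where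
  "mt_iso M N f \<longleftrightarrow> f \<in> proper_mt_morphisms M N \<and>
     (\<exists>g\<in>proper_mt_morphisms N M. compose (carrier M) g f = mt_id M \<and>
                                   compose (carrier N) f g = mt_id N)"


section \<open>The functors and the units\<close>

definition Pw :: "'a topology \<Rightarrow> 'a set mt" where
  "Pw X = \<lparr>carrier = Pow (topspace X), eq = (=), le = (\<subseteq>), box = (\<lambda>A. X interior_of A)\<rparr>"

definition Pw_map :: "'a topology \<Rightarrow> 'b topology \<Rightarrow> ('a \<Rightarrow> 'b) \<Rightarrow> 'b set \<Rightarrow> 'a set" where
  "Pw_map X Y f = (\<lambda>B\<in>carrier (Pw Y). {x \<in> topspace X. f x \<in> B})"

definition \<eta> :: "('a, 'z) mt_scheme \<Rightarrow> 'a \<Rightarrow> 'a set" where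
  "\<eta> M = (\<lambda>a\<in>carrier M. {x \<in> atoms M. x \<sqsubseteq>\<^bsub>M\<^esub> a})"

definition at_space :: "('a, 'z) mt_scheme \<Rightarrow> 'a topology" where
  "at_space M = topology (\<lambda>U. U \<in> \<eta> M ` opens M)"

text \<open>The sets \<^term>\<open>\<eta> M a\<close> for \<open>a\<close> open are indeed the open sets of a topology on the atoms.\<close>

context mt_algebra
begin

lemma atom_le_sup:
  assumes S: "S \<subseteq> carrier M" and x: "x \<in> atoms M" and le: "x \<sqsubseteq> \<Squnion>S"
  shows "\<exists>s\<in>S. x \<sqsubseteq> s"
proof (rule ccontr)
  assume no: "\<not> (\<exists>s\<in>S. x \<sqsubseteq> s)"
  have xc: "x \<in> carrier M" and x0: "x \<noteq> \<bottom>"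
    and xmin: "\<And>y. y \<in> carrier M \<Longrightarrow> y \<sqsubseteq> x \<Longrightarrow> y = \<bottom> \<or> y = x"
    using x by (auto simp: atoms_def)
  obtain y where y: "y \<in> carrier M" "x \<sqinter> y = \<bottom>" "x \<squnion> y = \<top>"
    using complement_exists[OF xc] by blast
  have "s \<sqsubseteq> y" if "s \<in> S" for s
  proof -
    have sc: "s \<in> carrier M" using that S by auto
    have "x \<sqinter> s = \<bottom> \<or> x \<sqinter> s = x" using xmin[of "x \<sqinter> s"] sc xc meet_left by auto
    moreover have "x \<sqinter> s \<noteq> x" using no that sc xc meet_right by metis
    ultimately have d: "x \<sqinter> s = \<bottom>" by blast
    have "s = s \<sqinter> (x \<squnion> y)" using y sc le_iff_join[of s "\<top>"] by simp
    also have "\<dots> = (s \<sqinter> x) \<squnion> (s \<sqinter> y)" using sc xc y(1) meet_join_distrib by simp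
    also have "s \<sqinter> x = \<bottom>" using d by (simp add: meet_comm)
    also have "\<bottom> \<squnion> (s \<sqinter> y) = s \<sqinter> y"
      using sc y le_iff_meet[of "\<bottom>" "s \<sqinter> y"] by simp
    finally have "s = s \<sqinter> y" .
    then show ?thesis using sc y le_iff_join by simp
  qed
  then have "\<Squnion>S \<sqsubseteq> y" using S y by (intro sup_least) (auto simp: Upper_def)
  then have "x \<sqsubseteq> y" using le xc y S by (meson le_trans sup_closed)
  then have "x = x \<sqinter> y" using xc y(1) le_iff_join by simp
  then show False using x0 y(2) by simp
qed

lemma opens_sup_closed:
  assumes S: "S \<subseteq> opens M"
  shows "\<Squnion>S \<in> opens M"
proof -
  have Sc: "S \<subseteq> carrier M" using S by (auto simp: opens_def)
  have c: "\<Squnion>S \<in> carrier M" using Sc by simp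
  have mono: "\<box> a \<sqsubseteq> \<box> b" if "a \<in> carrier M" "b \<in> carrier M" "a \<sqsubseteq> b" for a b
  proof -
    have "a = a \<sqinter> b" using that le_iff_join by simp
    then have "\<box> a = \<box> a \<sqinter> \<box> b" using that box_meet[of a b] by simp
    then show ?thesis using that box_closed le_iff_join by simp
  qed
  have "s \<sqsubseteq> \<box> (\<Squnion>S)" if "s \<in> S" for s
  proof -
    have "s = \<box> s" "s \<in> carrier M" using that S by (auto simp: opens_def)
    then show ?thesis using mono[of s "\<Squnion>S"] c that Sc by (metis sup_upper)
  qed
  then have "\<Squnion>S \<sqsubseteq> \<box> (\<Squnion>S)" using Sc c box_closed by (intro sup_least) (auto simp: Upper_def)
  then show ?thesis using c box_le box_closed by (auto simp: opens_def intro: le_antisym)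
qed

lemma openin_at_space: "openin (at_space M) U \<longleftrightarrow> (\<exists>a\<in>opens M. U = \<eta> M a)"
proof -
  have oc: "a \<in> carrier M" if "a \<in> opens M" for a using that by (simp add: opens_def)
  have "istopology (\<lambda>U. U \<in> \<eta> M ` opens M)"
    unfolding istopology_def
  proof (intro conjI allI impI)
    fix U V assume "U \<in> \<eta> M ` opens M" "V \<in> \<eta> M ` opens M"
    then obtain a b where ab: "a \<in> opens M" "b \<in> opens M" "U = \<eta> M a" "V = \<eta> M b" by blast
    then have "a \<sqinter> b \<in> opens M" using box_meet by (auto simp: opens_def)
    moreover have "U \<inter> V = \<eta> M (a \<sqinter> b)"
    proof -
      have c: "a \<in> carrier M" "b \<in> carrier M" using ab oc by auto
      have "x \<sqsubseteq> a \<sqinter> b \<longleftrightarrow> x \<sqsubseteq> a \<and> x \<sqsubseteq> b" if "x \<in> carrier M" for x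
        using that c by (meson le_trans meet_closed meet_le meet_left meet_right)
      then show ?thesis using ab c by (auto simp: \<eta>_def atoms_def)
    qed
    ultimately show "U \<inter> V \<in> \<eta> M ` opens M" by blast
  next
    fix \<U> assume "\<forall>U\<in>\<U>. U \<in> \<eta> M ` opens M"
    define S where "S = {a \<in> opens M. \<eta> M a \<in> \<U>}"
    have S: "S \<subseteq> opens M" "S \<subseteq> carrier M" using oc by (auto simp: S_def)
    have U: "\<Union>\<U> = (\<Union>a\<in>S. \<eta> M a)"
      using \<open>\<forall>U\<in>\<U>. U \<in> \<eta> M ` opens M\<close> by (fastforce simp: S_def)
    have "\<Union>\<U> = \<eta> M (\<Squnion>S)"
    proof
      show "\<Union>\<U> \<subseteq> \<eta> M (\<Squnion>S)"
      proof
        fix x assume "x \<in> \<Union>\<U>"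
        then obtain a where a: "a \<in> S" "x \<in> \<eta> M a" using U by auto
        have ac: "a \<in> carrier M" using a S by auto
        have "x \<in> atoms M" "x \<in> carrier M" "x \<sqsubseteq> a" using a ac by (auto simp: \<eta>_def atoms_def)
        moreover have "a \<sqsubseteq> \<Squnion>S" using a S by (simp add: sup_upper)
        ultimately have "x \<sqsubseteq> \<Squnion>S" using ac S by (meson le_trans sup_closed)
        then show "x \<in> \<eta> M (\<Squnion>S)" using \<open>x \<in> atoms M\<close> S by (simp add: \<eta>_def)
      qed
      show "\<eta> M (\<Squnion>S) \<subseteq> \<Union>\<U>"
      proof
        fix x assume "x \<in> \<eta> M (\<Squnion>S)"
        then have x: "x \<in> atoms M" "x \<sqsubseteq> \<Squnion>S" using S by (auto simp: \<eta>_def)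
        then obtain s where s: "s \<in> S" "x \<sqsubseteq> s" using atom_le_sup[OF S(2)] by blast
        then have "x \<in> \<eta> M s" using x S by (auto simp: \<eta>_def)
        then show "x \<in> \<Union>\<U>" using U s by auto
      qed
    qed
    then show "\<Union>\<U> \<in> \<eta> M ` opens M" using opens_sup_closed[OF S(1)] by blast
  qed
  then show ?thesis by (auto simp: at_space_def)
qed

lemma topspace_at_space: "topspace (at_space M) = atoms M"
proof -
  have "\<top> \<in> opens M" using box_top by (simp add: opens_def)
  moreover have "\<eta> M \<top> = atoms M" by (auto simp: \<eta>_def atoms_def)
  ultimately have "openin (at_space M) (atoms M)" using openin_at_space by blast
  moreover have "\<eta> M a \<subseteq> atoms M" if "a \<in> opens M" for a
    using that by (auto simp: \<eta>_def opens_def)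
  then have "U \<subseteq> atoms M" if "openin (at_space M) U" for U
    using that openin_at_space by auto
  ultimately show ?thesis
    by (metis openin_subset openin_topspace subset_antisym)
qed

end

definition at_map ::
    "('a, 'y) mt_scheme \<Rightarrow> ('b, 'z) mt_scheme \<Rightarrow> ('a \<Rightarrow> 'b) \<Rightarrow> 'b \<Rightarrow> 'a" where
  "at_map M N f = (\<lambda>x\<in>atoms N. \<Sqinter>\<^bsub>M\<^esub> {a \<in> carrier M. x \<sqsubseteq>\<^bsub>N\<^esub> f a})"

definition \<epsilon> :: "'a topology \<Rightarrow> 'a \<Rightarrow> 'a set" where
  "\<epsilon> X = (\<lambda>x\<in>topspace X. {x})"

end

theory Submission
  imports Defs
begin

text \<open>The heart of the matter is that a sober algebra has enough atoms to test compactness: if \<open>k\<close> is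
  compact saturated, \<open>u\<close> is open and \<open>k\<close> is not below \<open>u\<close>, then an open \<open>p\<close> above \<open>u\<close> that is maximal
  among those not above \<open>k\<close> is prime.  By sobriety the complement of \<open>p\<close> is the closure of an atom,
  and this atom lies below \<open>k\<close> but not below \<open>u\<close>.  Hence \<open>\<eta>\<close> is a bijection between the compact
  saturated elements of the algebra and the compact saturated sets of its atoms, and under local
  compactness \<open>\<eta>\<close> is injective on open elements, even if the algebra is not spatial.  Sobriety, local
  compactness and stability of the space of atoms, and properness of \<open>\<eta>\<close> and of \<open>at\<close> on morphisms,
  are then read off from the algebra.\<close>

section \<open>Complete boolean algebras\<close>

text \<open>The obstacle is that \<open>M\<close> need not be spatial: an element is not determined
  by the atoms below it, so inclusions between sets \<open>\<eta> M a\<close> need not give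
  inequalities in \<open>M\<close>. What survives is one comparison,
  \<open>KS_le_open_iff_atoms\<close>. Compactness of \<open>k\<close> supplies the maximal open, by
  Zorn's lemma, and saturation of \<open>k\<close> is what puts the atom produced by sobriety below
  \<open>k\<close>; so the test applies to elements of \<open>KS M\<close>, and compact elements are
  first replaced by their saturations. Opens are compared through such elements, which local
  compactness interpolates, and closed elements through their complements. In the opposite direction
  a compact saturated set \<open>K\<close> of atoms has to be realised by an element of
  \<open>M\<close>; the meet of all opens whose atoms include \<open>K\<close> does it. Spatiality
  enters where \<open>\<eta> M\<close> has to be inverted on all elements, by sending a set of atoms
  to its join.\<close>

context complete_lattice
begin

lemma meet_bot [simp]: "x \<in> carrier L \<Longrightarrow> x \<sqinter> \<bottom> = \<bottom>"
  using meet_right[of x "\<bottom>"] by (auto intro: le_antisym)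

lemma bot_join [simp]: "x \<in> carrier L \<Longrightarrow> \<bottom> \<squnion> x = x"
  using le_iff_meet[of "\<bottom>" x] by simp

lemma meet_top [simp]: "x \<in> carrier L \<Longrightarrow> x \<sqinter> \<top> = x"
  using le_iff_join[of x "\<top>"] by simp

lemma le_meet_iff:
  "\<lbrakk>x \<in> carrier L; y \<in> carrier L; z \<in> carrier L\<rbrakk> \<Longrightarrow> z \<sqsubseteq> x \<sqinter> y \<longleftrightarrow> z \<sqsubseteq> x \<and> z \<sqsubseteq> y"
  by (meson le_trans meet_closed meet_le meet_left meet_right)

lemma le_inf_iff: "\<lbrakk>S \<subseteq> carrier L; z \<in> carrier L\<rbrakk> \<Longrightarrow> z \<sqsubseteq> \<Sqinter>S \<longleftrightarrow> (\<forall>s\<in>S. z \<sqsubseteq> s)"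
  by (meson in_mono inf_closed inf_greatest inf_lower le_trans)

lemma le_sup: "\<lbrakk>S \<subseteq> carrier L; s \<in> S; z \<in> carrier L; z \<sqsubseteq> s\<rbrakk> \<Longrightarrow> z \<sqsubseteq> \<Squnion>S"
  by (meson in_mono sup_closed sup_upper le_trans)

lemma sup_mono: "\<lbrakk>S \<subseteq> T; T \<subseteq> carrier L\<rbrakk> \<Longrightarrow> \<Squnion>S \<sqsubseteq> \<Squnion>T"
  by (intro sup_least) (auto intro: sup_upper)

lemma bot_eqI: "\<lbrakk>x \<in> carrier L; x \<sqsubseteq> \<bottom>\<rbrakk> \<Longrightarrow> x = \<bottom>"
  by (auto intro: le_antisym)

lemma sup_empty [simp]: "\<Squnion>{} = \<bottom>"
  using weak_sup_empty by (simp add: eq_is_equal)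

end

context complete_boolean_lattice
begin

lemma complement_unique:
  assumes "a \<in> carrier L" "b \<in> carrier L" "c \<in> carrier L"
    and "a \<sqinter> b = \<bottom>" "a \<squnion> b = \<top>" "a \<sqinter> c = \<bottom>" "a \<squnion> c = \<top>"
  shows "b = c"
proof -
  have *: "x \<sqsubseteq> y" if "x \<in> carrier L" "y \<in> carrier L" "a \<sqinter> x = \<bottom>" "a \<squnion> y = \<top>" for x y
  proof -
    have "x = x \<sqinter> (a \<squnion> y)" using that by simp
    also have "\<dots> = (x \<sqinter> a) \<squnion> (x \<sqinter> y)" using that assms(1) by (intro meet_join_distrib)
    also have "\<dots> = x \<sqinter> y" using that meet_comm[of L x a] by simp
    finally show ?thesis using that le_iff_join by blast
  qed
  show ?thesis using *[of b c] *[of c b] assms by (auto intro: le_antisym)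
qed

lemma compl_eqI:
  assumes "a \<in> carrier L" "b \<in> carrier L" "a \<sqinter> b = \<bottom>" "a \<squnion> b = \<top>"
  shows "\<sim> a = b"
  unfolding compl_def
proof (rule the_equality)
  show "c = b" if "c \<in> carrier L \<and> a \<sqinter> c = \<bottom> \<and> a \<squnion> c = \<top>" for c
    using that assms by (intro complement_unique[of a c b]) auto
qed (use assms in auto)

lemma
  assumes "a \<in> carrier L"
  shows compl_closed [simp]: "\<sim> a \<in> carrier L"
    and meet_compl [simp]: "a \<sqinter> \<sim> a = \<bottom>"
    and join_compl [simp]: "a \<squnion> \<sim> a = \<top>"
proof -
  obtain b where "b \<in> carrier L" "a \<sqinter> b = \<bottom>" "a \<squnion> b = \<top>"
    using complement_exists[OF assms] by blast
  moreover from this have "\<sim> a = b" using assms by (intro compl_eqI)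
  ultimately show "\<sim> a \<in> carrier L" "a \<sqinter> \<sim> a = \<bottom>" "a \<squnion> \<sim> a = \<top>" by simp_all
qed

lemma compl_compl [simp]: "a \<in> carrier L \<Longrightarrow> \<sim> \<sim> a = a"
  using meet_compl[of a] join_compl[of a]
  by (intro compl_eqI) (simp_all add: meet_comm[of L "\<sim> a"] join_comm[of L "\<sim> a"])

lemma le_compl_iff:
  assumes "a \<in> carrier L" "b \<in> carrier L"
  shows "a \<sqsubseteq> \<sim> b \<longleftrightarrow> a \<sqinter> b = \<bottom>"
proof
  assume "a \<sqsubseteq> \<sim> b"
  then have "a \<sqinter> b \<sqsubseteq> b \<sqinter> \<sim> b"
    using assms meet_left[of a b] meet_right[of a b] le_trans[of "a \<sqinter> b" a "\<sim> b"]
    by (subst le_meet_iff) simp_all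
  then show "a \<sqinter> b = \<bottom>" using assms by (simp add: bot_eqI)
next
  assume "a \<sqinter> b = \<bottom>"
  moreover have "a = a \<sqinter> (b \<squnion> \<sim> b)" using assms by simp
  ultimately have "a = a \<sqinter> \<sim> b" using assms meet_join_distrib[of a b "\<sim> b"] by simp
  then show "a \<sqsubseteq> \<sim> b" using assms le_iff_join by simp
qed

lemma le_compl_swap: "\<lbrakk>a \<in> carrier L; b \<in> carrier L\<rbrakk> \<Longrightarrow> a \<sqsubseteq> \<sim> b \<longleftrightarrow> b \<sqsubseteq> \<sim> a"
  by (simp add: le_compl_iff meet_comm)

lemma compl_le_compl_iff: "\<lbrakk>a \<in> carrier L; b \<in> carrier L\<rbrakk> \<Longrightarrow> \<sim> a \<sqsubseteq> \<sim> b \<longleftrightarrow> b \<sqsubseteq> a"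
  using le_compl_swap[of "\<sim> a" b] by simp

lemma compl_bot [simp]: "\<sim> \<bottom> = \<top>"
  by (rule compl_eqI) simp_all

lemma atomD:
  assumes "x \<in> atoms L"
  shows "x \<in> carrier L" "x \<noteq> \<bottom>" "\<lbrakk>y \<in> carrier L; y \<sqsubseteq> x\<rbrakk> \<Longrightarrow> y = \<bottom> \<or> y = x"
  using assms by (auto simp: atoms_def)

lemma atoms_closed [simp]: "x \<in> atoms L \<Longrightarrow> x \<in> carrier L"
  by (rule atomD)

lemma atom_not_le_bot: "x \<in> atoms L \<Longrightarrow> \<not> x \<sqsubseteq> \<bottom>"
  using bot_eqI atomD by blast

lemma atom_le_atom: "\<lbrakk>x \<in> atoms L; y \<in> atoms L; x \<sqsubseteq> y\<rbrakk> \<Longrightarrow> x = y"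
  using atomD by blast

text \<open>The meet of an atom with \<open>a\<close> is below the atom, so it is
  \<open>\<bottom>\<close> or the atom itself: atoms decide every element. This makes
  \<open>\<eta>\<close> preserve complements.\<close>

lemma atom_le_compl_iff:
  assumes "x \<in> atoms L" "a \<in> carrier L"
  shows "x \<sqsubseteq> \<sim> a \<longleftrightarrow> \<not> x \<sqsubseteq> a"
proof -
  have "x \<sqinter> a = \<bottom> \<or> x \<sqinter> a = x"
    using assms meet_left[of x a] atomD(3)[of x "x \<sqinter> a"] by simp
  then show ?thesis
    using assms atomD(2)[of x] le_compl_iff[of x a] le_iff_join[of x a] by auto
qed

end

section \<open>Open, closed and saturated elements\<close>

context mt_algebra
begin

lemma opens_carrier [simp]: "a \<in> opens M \<Longrightarrow> a \<in> carrier M"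
  by (simp add: opens_def)

lemma box_of_open: "u \<in> opens M \<Longrightarrow> \<box> u = u"
  unfolding opens_def by simp

lemma opensI: "\<lbrakk>a \<in> carrier M; a \<sqsubseteq> \<box> a\<rbrakk> \<Longrightarrow> a \<in> opens M"
  using box_le[of a] box_closed[of a] unfolding opens_def by (auto intro: le_antisym)

lemma opens_subset_carrier: "S \<subseteq> opens M \<Longrightarrow> S \<subseteq> carrier M"
  by auto

lemma box_mono: "\<lbrakk>a \<in> carrier M; b \<in> carrier M; a \<sqsubseteq> b\<rbrakk> \<Longrightarrow> \<box> a \<sqsubseteq> \<box> b"
  using box_meet[of a b] le_iff_join[of a b] le_iff_join[of "\<box> a" "\<box> b"]
  by (simp add: box_closed)

lemma box_open [simp]: "a \<in> carrier M \<Longrightarrow> \<box> a \<in> opens M"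
  by (simp add: box_box box_closed opensI)

lemma le_box: "\<lbrakk>u \<in> opens M; a \<in> carrier M; u \<sqsubseteq> a\<rbrakk> \<Longrightarrow> u \<sqsubseteq> \<box> a"
  using box_mono[of u a] by (simp add: box_of_open)

lemma top_open [simp]: "\<top> \<in> opens M"
  by (intro opensI) (simp_all add: box_top)

lemma join_open: "\<lbrakk>a \<in> opens M; b \<in> opens M\<rbrakk> \<Longrightarrow> a \<squnion> b \<in> opens M"
  by (simp add: join_def opens_sup_closed)

lemma closeds_iff: "c \<in> closeds M \<longleftrightarrow> c \<in> carrier M \<and> \<sim> c \<in> opens M"
proof -
  have "c = \<sim> \<box> \<sim> c \<longleftrightarrow> \<sim> c = \<box> \<sim> c" if c: "c \<in> carrier M"
  proof -
    have "\<sim> \<sim> c = c" "\<sim> \<sim> \<box> \<sim> c = \<box> \<sim> c" using c by (simp_all add: box_closed)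
    then show ?thesis by metis
  qed
  then show ?thesis unfolding closeds_def dia_def opens_def by auto
qed

lemma closeds_carrier [simp]: "a \<in> closeds M \<Longrightarrow> a \<in> carrier M"
  by (simp add: closeds_iff)

lemma compl_open_iff: "a \<in> carrier M \<Longrightarrow> \<sim> a \<in> closeds M \<longleftrightarrow> a \<in> opens M"
  by (simp add: closeds_iff)

lemma dia_closed [simp]: "a \<in> carrier M \<Longrightarrow> \<diamond> a \<in> closeds M"
  by (simp add: dia_def compl_open_iff box_closed)

lemma le_dia: "a \<in> carrier M \<Longrightarrow> a \<sqsubseteq> \<diamond> a"
  by (simp add: dia_def le_compl_swap[of a] box_closed box_le)

lemma dia_le: "\<lbrakk>a \<in> carrier M; c \<in> closeds M; a \<sqsubseteq> c\<rbrakk> \<Longrightarrow> \<diamond> a \<sqsubseteq> c"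
  using le_compl_swap[of "\<sim> \<box> (\<sim> a)" "\<sim> c"] le_box[of "\<sim> c" "\<sim> a"] compl_le_compl_iff[of c a]
  by (simp add: dia_def closeds_iff box_closed)

lemma saturateds_carrier [simp]: "k \<in> saturateds M \<Longrightarrow> k \<in> carrier M"
  by (auto simp: saturateds_def opens_subset_carrier)

lemma KS_carrier [simp]: "k \<in> KS M \<Longrightarrow> k \<in> carrier M"
  by (simp add: KS_def)

text \<open>A saturated element is a meet of opens, each of which lies above it, so the opens above
  it suffice as tests.\<close>

lemma saturatedE:
  assumes "k \<in> saturateds M" "x \<in> carrier M" "\<And>u. \<lbrakk>u \<in> opens M; k \<sqsubseteq> u\<rbrakk> \<Longrightarrow> x \<sqsubseteq> u"
  shows "x \<sqsubseteq> k"
proof -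
  obtain S where S: "S \<subseteq> opens M" "k = \<Sqinter>S" using assms(1) by (auto simp: saturateds_def)
  then show ?thesis
    using assms(2,3) inf_lower[of S] opens_subset_carrier[OF S(1)]
    by (auto simp: le_inf_iff)
qed

abbreviation saturation :: "'a \<Rightarrow> 'a" where
  "saturation a \<equiv> \<Sqinter>{u \<in> opens M. a \<sqsubseteq> u}"

lemma saturation_saturated: "saturation a \<in> saturateds M"
  by (auto simp: saturateds_def)

lemma saturation_le_open_iff:
  assumes "a \<in> carrier M" "u \<in> opens M"
  shows "saturation a \<sqsubseteq> u \<longleftrightarrow> a \<sqsubseteq> u"
proof -
  have c: "{u \<in> opens M. a \<sqsubseteq> u} \<subseteq> carrier M" by auto
  have "a \<sqsubseteq> saturation a" using assms c by (auto simp: le_inf_iff)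
  then show ?thesis
    using assms c inf_lower[OF c, of u] by (auto intro: le_trans)
qed

lemma le_saturation: "a \<in> carrier M \<Longrightarrow> a \<sqsubseteq> saturation a"
  by (subst le_inf_iff) auto

section \<open>Compact elements, their saturations, and prime opens\<close>

lemma compactE:
  assumes "a \<in> compacts M" "S \<subseteq> opens M" "a \<sqsubseteq> \<Squnion>S"
  obtains T where "T \<subseteq> S" "finite T" "a \<sqsubseteq> \<Squnion>T"
  using assms unfolding compacts_def by blast

text \<open>Opens cannot tell \<open>a\<close> from its saturation
  (\<open>saturation_le_open_iff\<close>), and compactness speaks of opens only. Hence the compact
  witness of \<open>\<lhd>\<close> may be replaced by one in \<open>KS M\<close>.\<close>

lemma saturation_KS:
  assumes "a \<in> compacts M"
  shows "saturation a \<in> KS M"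
proof -
  have ac: "a \<in> carrier M" using assms by (simp add: compacts_def)
  have "\<exists>T\<subseteq>S. finite T \<and> saturation a \<sqsubseteq> \<Squnion>T" if "S \<subseteq> opens M" "saturation a \<sqsubseteq> \<Squnion>S" for S
  proof -
    have eq: "saturation a \<sqsubseteq> \<Squnion>T \<longleftrightarrow> a \<sqsubseteq> \<Squnion>T" if "T \<subseteq> S" for T
      using that \<open>S \<subseteq> opens M\<close> ac by (intro saturation_le_open_iff opens_sup_closed) auto
    have "a \<sqsubseteq> \<Squnion>S" using eq that by simp
    with assms that(1) obtain T where "T \<subseteq> S" "finite T" "a \<sqsubseteq> \<Squnion>T"
      by (rule compactE)
    then show ?thesis using eq by auto
  qed
  then have "saturation a \<in> compacts M"
    using saturateds_carrier[OF saturation_saturated] by (simp add: compacts_def)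
  then show ?thesis using saturation_saturated by (simp add: KS_def)
qed

text \<open>Complementation exchanges opens with closeds and joins with meets, so primeness of
  \<open>p\<close> becomes irreducibility of \<open>\<sim> p\<close>. This is the bridge from a
  maximal open to the atom that sobriety supplies.\<close>

lemma join_irreducible_complI:
  assumes p: "p \<in> opens M" "p \<noteq> \<top>"
    and prime: "\<And>u w. \<lbrakk>u \<in> opens M; w \<in> opens M; u \<sqinter> w \<sqsubseteq> p\<rbrakk> \<Longrightarrow> u \<sqsubseteq> p \<or> w \<sqsubseteq> p"
  shows "\<sim> p \<in> join_irreducible_closeds M"
proof -
  have pc: "p \<in> carrier M" using p by simp
  have "\<sim> p = a \<or> \<sim> p = b" if ab: "a \<in> closeds M" "b \<in> closeds M" "\<sim> p = a \<squnion> b" for a b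
  proof -
    have c: "a \<in> carrier M" "b \<in> carrier M" "\<sim> a \<in> opens M" "\<sim> b \<in> opens M"
      using ab by (auto simp: closeds_iff)
    let ?z = "\<sim> a \<sqinter> \<sim> b"
    have z: "?z \<in> carrier M" using c by simp
    have "a \<sqsubseteq> \<sim> ?z" "b \<sqsubseteq> \<sim> ?z"
      using c z le_compl_swap[of a ?z] le_compl_swap[of b ?z] by (auto simp: meet_left meet_right)
    then have "\<sim> p \<sqsubseteq> \<sim> ?z" using ab(3) c z by (simp add: join_le)
    then have "?z \<sqsubseteq> p" using pc z by (simp add: compl_le_compl_iff)
    then have "\<sim> a \<sqsubseteq> p \<or> \<sim> b \<sqsubseteq> p" using prime c by blast
    then have "\<sim> p \<sqsubseteq> a \<or> \<sim> p \<sqsubseteq> b"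
      using compl_le_compl_iff[of "\<sim> a" p] compl_le_compl_iff[of "\<sim> b" p]
        compl_le_compl_iff[of p "\<sim> a"] compl_le_compl_iff[of p "\<sim> b"] pc c by auto
    moreover have "a \<sqsubseteq> \<sim> p" "b \<sqsubseteq> \<sim> p" using ab(3) c by (auto simp: join_left join_right)
    ultimately show ?thesis using c pc by (auto intro: le_antisym)
  qed
  moreover have "\<sim> p \<noteq> \<bottom>" using compl_compl[OF pc] p(2) by auto
  ultimately show ?thesis
    using p pc by (auto simp: join_irreducible_closeds_def compl_open_iff)
qed

text \<open>The opens not above a compact element \<open>k\<close> are stable under directed joins, and those above it
  form a filter; hence a maximal open not above \<open>k\<close> is prime.\<close>

lemma ex_prime_open_not_above_compact:
  assumes k: "k \<in> compacts M" and u: "u \<in> opens M" "\<not> k \<sqsubseteq> u"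
  shows "\<exists>p\<in>opens M. u \<sqsubseteq> p \<and> \<not> k \<sqsubseteq> p \<and> \<sim> p \<in> join_irreducible_closeds M"
proof -
  have kc: "k \<in> carrier M" using k by (simp add: compacts_def)
  define P where "P = {p \<in> opens M. u \<sqsubseteq> p \<and> \<not> k \<sqsubseteq> p}"
  define r where "r = {(p, q). p \<in> P \<and> q \<in> P \<and> p \<sqsubseteq> q}"
  have Pc: "p \<in> carrier M" if "p \<in> P" for p using that by (simp add: P_def)
  have "Partial_order r"
    using Pc by (auto simp: r_def partial_order_on_def preorder_on_def refl_on_def Field_def
        trans_def antisym_def intro: le_trans le_antisym)
  moreover have FP: "Field r = P" using Pc by (auto simp: r_def Field_def)
  moreover have "\<exists>b\<in>Field r. \<forall>a\<in>C. (a, b) \<in> r" if C: "C \<in> Chains r" for C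
  proof (cases "C = {}")
    case True
    \<comment> \<open>The empty chain is bounded by \<open>u\<close>; its join
      \<open>\<bottom>\<close> need not lie above \<open>u\<close>.\<close>
    then show ?thesis using u FP by (auto simp: P_def)
  next
    case False
    have CP: "C \<subseteq> P" using C by (auto simp: Chains_def r_def)
    then have Co: "C \<subseteq> opens M" and Cc: "C \<subseteq> carrier M" by (auto simp: P_def)
    have "\<not> k \<sqsubseteq> \<Squnion>C"
    proof
      assume "k \<sqsubseteq> \<Squnion>C"
      with k Co obtain T where T: "T \<subseteq> C" "finite T" "k \<sqsubseteq> \<Squnion>T"
        by (rule compactE)
      \<comment> \<open>A finite part of a nonempty chain has an upper bound in the chain, so a
        finite subcover would put \<open>k\<close> below one member of \<open>C\<close>, against
        \<open>C \<subseteq> P\<close>.\<close>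
      have "\<exists>c\<in>C. \<forall>t\<in>T. t \<sqsubseteq> c" using T(2,1)
      proof (induction T)
        case empty
        then show ?case using False by auto
      next
        case (insert t T)
        then obtain c where c: "c \<in> C" "\<forall>t\<in>T. t \<sqsubseteq> c" by auto
        have "t \<sqsubseteq> c \<or> c \<sqsubseteq> t" using C c insert by (auto simp: Chains_def r_def)
        moreover have "\<forall>s\<in>insert t T. s \<sqsubseteq> t" if "c \<sqsubseteq> t"
        proof
          fix s assume "s \<in> insert t T"
          moreover have "s \<in> carrier M" "c \<in> carrier M" "t \<in> carrier M"
            using \<open>s \<in> insert t T\<close> c insert.prems Cc by auto
          ultimately show "s \<sqsubseteq> t" using that c le_trans[of s c t] by auto
        qed
        ultimately show ?case using c insert.prems by auto
      qed
      then obtain c where c: "c \<in> C" "\<forall>t\<in>T. t \<sqsubseteq> c" by auto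
      then have "\<Squnion>T \<sqsubseteq> c" using T Cc by (intro sup_least) auto
      then have "k \<sqsubseteq> c" using T c Cc kc by (meson in_mono le_trans order_trans sup_closed)
      then show False using c CP by (auto simp: P_def)
    qed
    moreover have "u \<sqsubseteq> \<Squnion>C"
      using False CP le_sup[OF Cc, of _ u] u by (auto simp: P_def)
    ultimately have "\<Squnion>C \<in> P" using opens_sup_closed[OF Co] by (simp add: P_def)
    then show ?thesis using CP Cc FP by (auto simp: r_def sup_upper intro!: bexI[of _ "\<Squnion>C"])
  qed
  ultimately obtain p where p: "p \<in> P" and "\<And>q. \<lbrakk>q \<in> P; (p, q) \<in> r\<rbrakk> \<Longrightarrow> q = p"
    using Zorns_po_lemma[of r] by metis
  then have max: "q = p" if "q \<in> P" "p \<sqsubseteq> q" for q using that by (auto simp: r_def)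
  have po: "p \<in> opens M" and pc: "p \<in> carrier M" using p by (auto simp: P_def)
  \<comment> \<open>The join \<open>p \<squnion> w\<close> is open and above \<open>u\<close>, but
    by maximality of \<open>p\<close> it is outside \<open>P\<close>; hence it lies above
    \<open>k\<close>.\<close>
  have above: "k \<sqsubseteq> p \<squnion> w" if w: "w \<in> opens M" "\<not> w \<sqsubseteq> p" for w
  proof (rule ccontr)
    assume *: "\<not> k \<sqsubseteq> p \<squnion> w"
    have l: "p \<sqsubseteq> p \<squnion> w" "w \<sqsubseteq> p \<squnion> w" using pc w by (auto simp: join_left join_right)
    then have "u \<sqsubseteq> p \<squnion> w" using u p pc w by (auto simp: P_def intro: le_trans)
    then have "p \<squnion> w \<in> P" using * po w by (simp add: P_def join_open)
    then show False using max l w by metis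
  qed
  have "v \<sqsubseteq> p \<or> w \<sqsubseteq> p" if vw: "v \<in> opens M" "w \<in> opens M" "v \<sqinter> w \<sqsubseteq> p" for v w
  proof (rule ccontr)
    assume "\<not> (v \<sqsubseteq> p \<or> w \<sqsubseteq> p)"
    then have kv: "k \<sqsubseteq> p \<squnion> v" and kw: "k \<sqsubseteq> p \<squnion> w" using above vw by auto
    \<comment> \<open>\<open>?d\<close> is the part of \<open>k\<close> outside \<open>p\<close>. By
      distributivity \<open>k \<sqsubseteq> p \<squnion> z\<close> forces
      \<open>?d \<sqsubseteq> z\<close>, so \<open>?d\<close> is below
      \<open>v \<sqinter> w\<close>, hence below both \<open>p\<close> and its complement. Thus
      \<open>?d = \<bottom>\<close>, which means \<open>k \<sqsubseteq> p\<close>.\<close>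
    let ?d = "k \<sqinter> \<sim> p"
    have d: "?d \<in> carrier M" using kc pc by simp
    have le: "?d \<sqsubseteq> z" if z: "z \<in> opens M" "k \<sqsubseteq> p \<squnion> z" for z
    proof -
      have zc: "z \<in> carrier M" using z by simp
      have "?d \<sqsubseteq> p \<squnion> z" "?d \<sqsubseteq> \<sim> p"
        using d kc pc zc z(2) meet_left[of k "\<sim> p"] meet_right[of k "\<sim> p"]
        by (auto intro: le_trans[of ?d k])
      then have "?d = ?d \<sqinter> (p \<squnion> z)" "?d \<sqinter> p = \<bottom>" using d pc zc
        by (auto simp: le_compl_iff le_iff_join[symmetric])
      then have "?d = ?d \<sqinter> z" using meet_join_distrib[of ?d p z] d pc zc by simp
      then show ?thesis using d zc le_iff_join by blast
    qed
    have "?d \<sqsubseteq> v \<sqinter> w" using le vw kv kw d by (simp add: le_meet_iff)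
    then have "?d \<sqsubseteq> p" using d pc vw by (meson le_trans meet_closed opens_carrier)
    moreover have "?d \<sqsubseteq> \<sim> p" using kc pc by (simp add: meet_right)
    ultimately have "?d = \<bottom>" using d pc
      by (metis le_compl_iff le_iff_join)
    then have "k \<sqsubseteq> p" using kc pc le_compl_iff[of k "\<sim> p"] by simp
    then show False using p by (simp add: P_def)
  qed
  moreover have "p \<noteq> \<top>" using p kc by (auto simp: P_def)
  ultimately have "\<sim> p \<in> join_irreducible_closeds M" using join_irreducible_complI po by blast
  then show ?thesis using p po by (auto simp: P_def)
qed

lemma KS_le_open_iff_atoms:
  assumes sob: "sober_mt M" and k: "k \<in> KS M" and u: "u \<in> opens M"
  shows "k \<sqsubseteq> u \<longleftrightarrow> (\<forall>x\<in>atoms M. x \<sqsubseteq> k \<longrightarrow> x \<sqsubseteq> u)"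
proof (intro iffI ballI impI)
  show "x \<sqsubseteq> u" if "k \<sqsubseteq> u" "x \<in> atoms M" "x \<sqsubseteq> k" for x
    using that k u by (meson KS_carrier atoms_closed le_trans opens_carrier)
next
  assume *: "\<forall>x\<in>atoms M. x \<sqsubseteq> k \<longrightarrow> x \<sqsubseteq> u"
  show "k \<sqsubseteq> u"
  proof (rule ccontr)
    assume "\<not> k \<sqsubseteq> u"
    then obtain p where p: "p \<in> opens M" "u \<sqsubseteq> p" "\<not> k \<sqsubseteq> p"
        "\<sim> p \<in> join_irreducible_closeds M"
      using ex_prime_open_not_above_compact[of k u] k u by (auto simp: KS_def)
    then obtain x where x: "x \<in> atoms M" "\<sim> p = \<diamond> x"
      using sob by (auto simp: sober_mt_def)
    have np: "\<not> x \<sqsubseteq> p" using atom_le_compl_iff[OF x(1), of p] le_dia[of x] x p by simp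
    \<comment> \<open>Saturation of \<open>k\<close> reduces this to opens \<open>v\<close> above
      \<open>k\<close>. If \<open>x\<close> missed such a \<open>v\<close>, then \<open>x\<close>,
      and with it \<open>\<diamond> x = \<sim> p\<close>, would lie below the closed element
      \<open>\<sim> v\<close>, so that \<open>k \<sqsubseteq> v \<sqsubseteq> p\<close>.\<close>
    have "x \<sqsubseteq> k"
    proof (rule saturatedE)
      fix v assume v: "v \<in> opens M" "k \<sqsubseteq> v"
      show "x \<sqsubseteq> v"
      proof (rule ccontr)
        assume "\<not> x \<sqsubseteq> v"
        then have "\<sim> p \<sqsubseteq> \<sim> v"
          using x v by (metis atom_le_compl_iff atoms_closed compl_open_iff dia_le opens_carrier)
        then have "v \<sqsubseteq> p" using v p by (simp add: compl_le_compl_iff)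
        then show False using v p k by (meson KS_carrier le_trans opens_carrier)
      qed
    qed (use k x in \<open>auto simp: KS_def\<close>)
    then have "x \<sqsubseteq> u" using * x by blast
    then show False using np p u x by (meson atoms_closed le_trans opens_carrier)
  qed
qed

end

section \<open>The space of atoms\<close>

context mt_algebra
begin

lemma eta_eq: "a \<in> carrier M \<Longrightarrow> \<eta> M a = {x \<in> atoms M. x \<sqsubseteq> a}"
  by (simp add: \<eta>_def)

lemma eta_subset_atoms: "a \<in> carrier M \<Longrightarrow> \<eta> M a \<subseteq> atoms M"
  by (auto simp: eta_eq)

lemma eta_mono: "\<lbrakk>a \<in> carrier M; b \<in> carrier M; a \<sqsubseteq> b\<rbrakk> \<Longrightarrow> \<eta> M a \<subseteq> \<eta> M b"
  by (auto simp: eta_eq intro: le_trans)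

text \<open>Atoms are completely join-prime (\<open>atom_le_sup\<close>), so arbitrary joins become
  unions even when \<open>M\<close> is not spatial.\<close>

lemma eta_sup: "S \<subseteq> carrier M \<Longrightarrow> \<eta> M (\<Squnion>S) = \<Union>(\<eta> M ` S)"
  using atom_le_sup[of S] le_sup[of S] by (auto simp: eta_eq subset_iff)

lemma eta_inf: "S \<subseteq> carrier M \<Longrightarrow> \<eta> M (\<Sqinter>S) = atoms M \<inter> \<Inter>(\<eta> M ` S)"
  by (auto simp: eta_eq subset_iff le_inf_iff)

lemma eta_compl: "a \<in> carrier M \<Longrightarrow> \<eta> M (\<sim> a) = atoms M - \<eta> M a"
  by (auto simp: eta_eq atom_le_compl_iff)

lemma eta_join: "\<lbrakk>a \<in> carrier M; b \<in> carrier M\<rbrakk> \<Longrightarrow> \<eta> M (a \<squnion> b) = \<eta> M a \<union> \<eta> M b"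
  by (simp add: join_def eta_sup)

lemma eta_meet: "\<lbrakk>a \<in> carrier M; b \<in> carrier M\<rbrakk> \<Longrightarrow> \<eta> M (a \<sqinter> b) = \<eta> M a \<inter> \<eta> M b"
  by (auto simp: eta_eq le_meet_iff)

lemma eta_atom: "x \<in> atoms M \<Longrightarrow> \<eta> M x = {x}"
  by (auto simp: eta_eq atom_le_atom)

lemma closedin_at_space: "closedin (at_space M) C \<longleftrightarrow> (\<exists>c\<in>closeds M. C = \<eta> M c)"
proof
  assume "closedin (at_space M) C"
  then obtain u where u: "u \<in> opens M" "atoms M - C = \<eta> M u" "C \<subseteq> atoms M"
    by (auto simp: closedin_def topspace_at_space openin_at_space)
  then have "C = \<eta> M (\<sim> u)" by (auto simp: eta_compl)
  then show "\<exists>c\<in>closeds M. C = \<eta> M c" using u by (auto simp: compl_open_iff)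
next
  assume "\<exists>c\<in>closeds M. C = \<eta> M c"
  then obtain c where c: "c \<in> closeds M" "C = \<eta> M c" by blast
  moreover from c have "atoms M - \<eta> M c = \<eta> M (\<sim> c)" by (simp add: eta_compl)
  ultimately show "closedin (at_space M) C"
    using eta_subset_atoms[of c]
    by (auto simp: closedin_def topspace_at_space openin_at_space closeds_iff)
qed

lemma saturatedin_eta:
  assumes "k \<in> saturateds M"
  shows "saturatedin (at_space M) (\<eta> M k)"
proof -
  obtain S where S: "S \<subseteq> opens M" "k = \<Sqinter>S" using assms by (auto simp: saturateds_def)
  then have "\<eta> M k = atoms M \<inter> \<Inter>(\<eta> M ` S)" using opens_subset_carrier by (simp add: eta_inf)
  moreover have "\<forall>U\<in>\<eta> M ` S. openin (at_space M) U" using S by (auto simp: openin_at_space)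
  ultimately show ?thesis unfolding saturatedin_def topspace_at_space by blast
qed

text \<open>The closed sets are the \<open>\<eta> M c\<close> with \<open>c\<close> closed, and for
  such \<open>c\<close> the conditions \<open>x \<sqsubseteq> c\<close> and
  \<open>\<diamond> x \<sqsubseteq> c\<close> agree.\<close>

lemma at_space_closure_of_atom:
  assumes x: "x \<in> atoms M"
  shows "at_space M closure_of {x} = \<eta> M (\<diamond> x)"
proof (rule closure_of_unique)
  show "{x} \<subseteq> \<eta> M (\<diamond> x)" using x by (simp add: eta_eq le_dia)
  show "closedin (at_space M) (\<eta> M (\<diamond> x))" using x closedin_at_space by auto
  show "\<eta> M (\<diamond> x) \<subseteq> T" if "{x} \<subseteq> T" "closedin (at_space M) T" for T
  proof -
    obtain c where c: "c \<in> closeds M" "T = \<eta> M c" using \<open>closedin _ T\<close> closedin_at_space by auto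
    then have "\<diamond> x \<sqsubseteq> c" using \<open>{x} \<subseteq> T\<close> x by (auto simp: eta_eq intro: dia_le)
    then show ?thesis using c x by (simp add: eta_mono)
  qed
qed

section \<open>Compact saturated sets of atoms\<close>

lemma compactin_eta:
  assumes sob: "sober_mt M" and k: "k \<in> KS M"
  shows "compactin (at_space M) (\<eta> M k)"
  unfolding compactin_def
proof (intro conjI allI impI)
  show "\<eta> M k \<subseteq> topspace (at_space M)" using k by (simp add: topspace_at_space eta_subset_atoms)
  fix \<U> assume U: "Ball \<U> (openin (at_space M)) \<and> \<eta> M k \<subseteq> \<Union>\<U>"
  \<comment> \<open>A set in \<open>\<U>\<close> may be the image of several opens; all of them are
    taken, so no choice is made.\<close>
  define S where "S = {u \<in> opens M. \<eta> M u \<in> \<U>}"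
  have S: "S \<subseteq> opens M" "S \<subseteq> carrier M" by (auto simp: S_def)
  have "\<Union>\<U> \<subseteq> \<Union>(\<eta> M ` S)" using U by (fastforce simp: S_def openin_at_space)
  then have "\<eta> M k \<subseteq> \<eta> M (\<Squnion>S)" using U unfolding eta_sup[OF S(2)] by blast
  \<comment> \<open>An inclusion of sets of atoms becomes an inequality here because
    \<open>k\<close> is in \<open>KS M\<close>, \<open>\<Squnion>S\<close> is open and
    \<open>M\<close> is sober.\<close>
  then have "k \<sqsubseteq> \<Squnion>S"
    using S k KS_le_open_iff_atoms[OF sob k opens_sup_closed[OF S(1)]] by (auto simp: eta_eq)
  moreover have "k \<in> compacts M" using k by (simp add: KS_def)
  ultimately obtain T where T: "T \<subseteq> S" "finite T" "k \<sqsubseteq> \<Squnion>T"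
    using compactE[OF _ S(1)] by blast
  have Tc: "T \<subseteq> carrier M" using T S by auto
  have "\<eta> M k \<subseteq> \<eta> M (\<Squnion>T)" using T k Tc by (intro eta_mono) auto
  then have "\<eta> M k \<subseteq> \<Union>(\<eta> M ` T)" using Tc by (simp add: eta_sup)
  moreover have "\<eta> M ` T \<subseteq> \<U>" using T by (auto simp: S_def)
  ultimately show "\<exists>\<F>. finite \<F> \<and> \<F> \<subseteq> \<U> \<and> \<eta> M k \<subseteq> \<Union>\<F>" using T by blast
qed

text \<open>The candidate is the meet of all opens \<open>u\<close> with
  \<open>K \<subseteq> \<eta> M u\<close>. Its compactness is that of \<open>K\<close>: a cover of
  the meet gives a cover of \<open>K\<close>, and the join of a finite subcover is itself one of the
  opens over which the meet is taken.\<close>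

lemma compact_saturated_at_spaceE:
  assumes K: "compactin (at_space M) K" "saturatedin (at_space M) K"
  obtains k where "k \<in> KS M" "K = \<eta> M k"
proof -
  define S where "S = {u \<in> opens M. K \<subseteq> \<eta> M u}"
  have S: "S \<subseteq> opens M" "S \<subseteq> carrier M" by (auto simp: S_def)
  obtain \<U> where U: "\<forall>U\<in>\<U>. openin (at_space M) U" "K = atoms M \<inter> \<Inter>\<U>"
    using K(2) by (auto simp: saturatedin_def topspace_at_space)
  have "\<U> \<subseteq> \<eta> M ` S"
  proof
    fix V assume "V \<in> \<U>"
    then obtain u where "u \<in> opens M" "V = \<eta> M u" using U by (auto simp: openin_at_space)
    then show "V \<in> \<eta> M ` S" using U \<open>V \<in> \<U>\<close> by (auto simp: S_def)
  qed
  then have eq: "K = \<eta> M (\<Sqinter>S)" using U S by (auto simp: eta_inf S_def)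
  have "\<Sqinter>S \<in> saturateds M" using S by (auto simp: saturateds_def)
  moreover have "\<exists>T'\<subseteq>T. finite T' \<and> \<Sqinter>S \<sqsubseteq> \<Squnion>T'" if T: "T \<subseteq> opens M" "\<Sqinter>S \<sqsubseteq> \<Squnion>T" for T
  proof -
    have Tc: "T \<subseteq> carrier M" using T by auto
    have "K \<subseteq> \<eta> M (\<Squnion>T)" unfolding eq using T Tc S by (intro eta_mono) auto
    then have "K \<subseteq> \<Union>(\<eta> M ` T)" using Tc by (simp add: eta_sup)
    moreover have "\<And>U. U \<in> \<eta> M ` T \<Longrightarrow> openin (at_space M) U"
      using T by (auto simp: openin_at_space)
    ultimately obtain \<F> where F: "finite \<F>" "\<F> \<subseteq> \<eta> M ` T" "K \<subseteq> \<Union>\<F>"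
      using K(1) compactinD[of "at_space M" K "\<eta> M ` T"] by metis
    then obtain T' where T': "T' \<subseteq> T" "finite T'" "\<F> = \<eta> M ` T'"
      by (meson finite_subset_image)
    have "T' \<subseteq> opens M" "T' \<subseteq> carrier M" using T' T by auto
    then have "\<eta> M (\<Squnion>T') = \<Union>\<F>" using T' by (simp add: eta_sup)
    then have "\<Squnion>T' \<in> S" using F opens_sup_closed[OF \<open>T' \<subseteq> opens M\<close>] by (simp add: S_def)
    then have "\<Sqinter>S \<sqsubseteq> \<Squnion>T'" using S by (intro inf_lower) auto
    then show ?thesis using T' by blast
  qed
  ultimately have "\<Sqinter>S \<in> KS M" using inf_closed[OF S(2)] unfolding KS_def compacts_def by blast
  then show ?thesis using eq that by blast
qed

section \<open>Local compactness and sobriety of the space of atoms\<close>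

lemma compactly_belowE:
  assumes "a \<lhd>\<^bsub>M\<^esub> u" "a \<in> carrier M" "u \<in> opens M"
  obtains k where "k \<in> KS M" "a \<sqsubseteq> k" "k \<sqsubseteq> u"
proof -
  obtain c where c: "c \<in> compacts M" "a \<sqsubseteq> c" "c \<sqsubseteq> u"
    using assms(1) by (auto simp: compactly_below_def)
  have cc: "c \<in> carrier M" using c by (simp add: compacts_def)
  \<comment> \<open>The witness \<open>c\<close> is enlarged to its saturation, which stays below
    \<open>u\<close> because \<open>u\<close> is open.\<close>
  have "saturation c \<in> KS M" using c by (simp add: saturation_KS)
  moreover from this have "a \<sqsubseteq> saturation c"
    using le_saturation[OF cc] c cc assms(2) KS_carrier le_trans[of a c] by blast
  moreover have "saturation c \<sqsubseteq> u" using c cc assms(3) by (simp add: saturation_le_open_iff)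
  ultimately show ?thesis using that by blast
qed

lemma open_eq_sup_compactly_below:
  "\<lbrakk>locally_compact_mt M; u \<in> opens M\<rbrakk> \<Longrightarrow> u = \<Squnion>{v \<in> opens M. v \<lhd>\<^bsub>M\<^esub> u}"
  by (simp add: locally_compact_mt_def)

text \<open>Local compactness writes \<open>u\<close> as a join of opens \<open>w\<close> with
  \<open>w \<sqsubseteq> k \<sqsubseteq> u\<close> for some \<open>k\<close> in \<open>KS M\<close>.
  The atoms below \<open>k\<close> are below \<open>u\<close>, hence below \<open>v\<close>, so
  \<open>KS_le_open_iff_atoms\<close> gives \<open>k \<sqsubseteq> v\<close>. The interpolated
  \<open>k\<close> does the work of spatiality.\<close>

lemma eta_open_le_iff:
  assumes lc: "locally_compact_mt M" and sob: "sober_mt M" and u: "u \<in> opens M" and v: "v \<in> opens M"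
  shows "\<eta> M u \<subseteq> \<eta> M v \<longleftrightarrow> u \<sqsubseteq> v"
proof
  show "\<eta> M u \<subseteq> \<eta> M v" if "u \<sqsubseteq> v" using that u v by (simp add: eta_mono)
next
  assume le: "\<eta> M u \<subseteq> \<eta> M v"
  have "w \<sqsubseteq> v" if w: "w \<in> opens M" "w \<lhd>\<^bsub>M\<^esub> u" for w
  proof -
    obtain k where k: "k \<in> KS M" "w \<sqsubseteq> k" "k \<sqsubseteq> u" using w u by (auto elim: compactly_belowE)
    have "\<eta> M k \<subseteq> \<eta> M v" using eta_mono[of k u] k u le by auto
    then have "k \<sqsubseteq> v" using k v by (auto simp: KS_le_open_iff_atoms[OF sob] eta_eq)
    then show ?thesis using k v w le_trans[of w k v] by simp
  qed
  then have "\<Squnion>{w \<in> opens M. w \<lhd>\<^bsub>M\<^esub> u} \<sqsubseteq> v" using v by (intro sup_least) auto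
  then show "u \<sqsubseteq> v" using open_eq_sup_compactly_below[OF lc u] by simp
qed

lemma eta_open_eq_iff:
  assumes "locally_compact_mt M" "sober_mt M" "u \<in> opens M" "v \<in> opens M"
  shows "\<eta> M u = \<eta> M v \<longleftrightarrow> u = v"
  using eta_open_le_iff[OF assms] eta_open_le_iff[OF assms(1,2,4,3)] assms by (auto intro: le_antisym)

lemma neighbourhood_base_at_space:
  assumes lc: "locally_compact_mt M" and sob: "sober_mt M"
  shows "neighbourhood_base_of (compactin (at_space M)) (at_space M)"
  unfolding neighbourhood_base_of
proof (intro allI impI)
  fix W x assume "openin (at_space M) W \<and> x \<in> W"
  then obtain u where u: "u \<in> opens M" "W = \<eta> M u" "x \<in> atoms M" "x \<sqsubseteq> u"
    by (auto simp: openin_at_space eta_eq)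
  then have "x \<sqsubseteq> \<Squnion>{v \<in> opens M. v \<lhd>\<^bsub>M\<^esub> u}" using open_eq_sup_compactly_below[OF lc] by simp
  \<comment> \<open>Complete join-primeness of the atom singles out one member of the join.\<close>
  then obtain v where v: "v \<in> opens M" "v \<lhd>\<^bsub>M\<^esub> u" "x \<sqsubseteq> v"
    using atom_le_sup[of "{v \<in> opens M. v \<lhd>\<^bsub>M\<^esub> u}" x] u by (auto simp: subset_iff)
  then obtain k where k: "k \<in> KS M" "v \<sqsubseteq> k" "k \<sqsubseteq> u" using u by (auto elim: compactly_belowE)
  have "openin (at_space M) (\<eta> M v)" "compactin (at_space M) (\<eta> M k)" "x \<in> \<eta> M v"
      "\<eta> M v \<subseteq> \<eta> M k" "\<eta> M k \<subseteq> W"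
    using u v k compactin_eta[OF sob] by (auto simp: openin_at_space eta_mono) (auto simp: eta_eq intro: le_trans)
  then show "\<exists>U V. openin (at_space M) U \<and> compactin (at_space M) V \<and> x \<in> U \<and> U \<subseteq> V \<and> V \<subseteq> W"
    by blast
qed

text \<open>An atom below a join is below a member, which is in turn below the atom; so
  \<open>x\<close> itself is weakly locally closed, \<open>x = k \<sqinter> c\<close>. Whether an
  atom lies below \<open>k\<close> and below \<open>c\<close> is governed by the opens above it, so
  \<open>y \<sqsubseteq> x\<close>.\<close>

lemma T0_atoms_eq:
  assumes T0: "T0_algebra M" and x: "x \<in> atoms M" and y: "y \<in> atoms M"
    and same: "\<And>u. u \<in> opens M \<Longrightarrow> x \<sqsubseteq> u \<longleftrightarrow> y \<sqsubseteq> u"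
  shows "x = y"
proof -
  obtain S where S: "S \<subseteq> weakly_locally_closeds M" "x = \<Squnion>S"
    using T0 x unfolding T0_algebra_def by (meson atoms_closed)
  have Sc: "S \<subseteq> carrier M" using S(1) by (auto simp: weakly_locally_closeds_def)
  obtain s where s: "s \<in> S" "x \<sqsubseteq> s" using atom_le_sup[OF Sc x] S x by auto
  have "s = x" using s Sc S x sup_upper[OF Sc s(1)] by (auto intro: le_antisym)
  then obtain k c where kc: "k \<in> saturateds M" "c \<in> closeds M" "x = k \<sqinter> c"
    using s S by (auto simp: weakly_locally_closeds_def)
  have xk: "x \<sqsubseteq> k" and xc: "x \<sqsubseteq> c" using kc by (auto simp: meet_left meet_right)
  have "y \<sqsubseteq> c"
    using same[of "\<sim> c"] xc atom_le_compl_iff[OF x, of c] atom_le_compl_iff[OF y, of c] kc(2)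
    by (auto simp: closeds_iff)
  moreover have "y \<sqsubseteq> k"
  proof (rule saturatedE[OF kc(1)])
    show "y \<sqsubseteq> u" if "u \<in> opens M" "k \<sqsubseteq> u" for u
      using same[OF that(1)] that xk kc(1) x le_trans[of x k u] by simp
  qed (use y in simp)
  ultimately have "y \<sqsubseteq> x" using kc y by (simp add: le_meet_iff)
  then show ?thesis using atom_le_atom x y by blast
qed

lemma sober_at_space:
  assumes lc: "locally_compact_mt M" and sob: "sober_mt M"
  shows "sober_space (at_space M)"
  unfolding sober_space_def
proof (intro allI impI)
  fix C assume C: "irreducible_closedin (at_space M) C"
  then obtain c where c: "c \<in> closeds M" "C = \<eta> M c"
    by (auto simp: irreducible_closedin_def closedin_at_space)
  \<comment> \<open>Irreducibility has to be moved from sets to elements, which needs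
    \<open>\<eta>\<close> to be injective on closed elements; complements reduce this to
    opens.\<close>
  have eta_eq_closeds: "a = b" if "a \<in> closeds M" "b \<in> closeds M" "\<eta> M a = \<eta> M b" for a b
  proof -
    have "\<eta> M (\<sim> a) = \<eta> M (\<sim> b)" using that by (simp add: eta_compl)
    then have "\<sim> a = \<sim> b" using that eta_open_eq_iff[OF lc sob] by (simp add: closeds_iff)
    then show ?thesis using that compl_compl by (metis closeds_carrier)
  qed
  have "c \<in> join_irreducible_closeds M"
    unfolding join_irreducible_closeds_def mem_Collect_eq
  proof (intro conjI ballI impI)
    have "\<eta> M \<bottom> = {}" by (auto simp: eta_eq atom_not_le_bot)
    then show "c \<noteq> \<bottom>" using C c by (auto simp: irreducible_closedin_def)
    fix a b assume ab: "a \<in> closeds M" "b \<in> closeds M" "c = a \<squnion> b"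
    then have "C = \<eta> M a \<union> \<eta> M b" using c by (simp add: eta_join)
    then have "C = \<eta> M a \<or> C = \<eta> M b"
      using C ab closedin_at_space unfolding irreducible_closedin_def by blast
    then show "c = a \<or> c = b" using eta_eq_closeds ab c by blast
  qed (use c in simp)
  then obtain x where x: "x \<in> atoms M" "c = \<diamond> x" using sob by (auto simp: sober_mt_def)
  show "\<exists>!x. x \<in> topspace (at_space M) \<and> C = at_space M closure_of {x}"
  proof (intro ex1I conjI)
    show "x \<in> topspace (at_space M)" "C = at_space M closure_of {x}"
      using x c by (auto simp: topspace_at_space at_space_closure_of_atom)
    fix y assume y: "y \<in> topspace (at_space M) \<and> C = at_space M closure_of {y}"
    then have ya: "y \<in> atoms M" by (simp add: topspace_at_space)
    have dia: "\<eta> M (\<diamond> x) = \<eta> M (\<diamond> y)" using c x y ya by (simp add: at_space_closure_of_atom)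
    have "\<diamond> x = \<diamond> y" using eta_eq_closeds[OF _ _ dia] x ya by simp
    \<comment> \<open>The closure of an atom determines the opens above it, so
      \<open>T0_atoms_eq\<close> yields uniqueness of the generic point.\<close>
    moreover have "z \<sqsubseteq> u \<longleftrightarrow> \<not> \<diamond> z \<sqsubseteq> \<sim> u" if "z \<in> atoms M" "u \<in> opens M" for z u
      using that dia_le[of z "\<sim> u"] le_trans[of z "\<diamond> z" "\<sim> u"] le_dia[of z]
      by (auto simp: atom_le_compl_iff compl_open_iff)
    ultimately show "y = x"
      using T0_atoms_eq[of x y] sob x ya by (auto simp: sober_mt_def)
  qed
qed

lemma stably_locally_compact_at_space:
  assumes "stably_locally_compact_mt M"
  shows "stably_locally_compact_space (at_space M)"
proof -
  have lc: "locally_compact_mt M" and sob: "sober_mt M"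
    and KS: "\<And>k m. \<lbrakk>k \<in> KS M; m \<in> KS M\<rbrakk> \<Longrightarrow> k \<sqinter> m \<in> KS M"
    using assms by (auto simp: stably_locally_compact_mt_def)
  have "compactin (at_space M) (K \<inter> L)"
    if KL: "compactin (at_space M) K" "saturatedin (at_space M) K"
       "compactin (at_space M) L" "saturatedin (at_space M) L" for K L
  proof -
    obtain k where k: "k \<in> KS M" "K = \<eta> M k"
      by (rule compact_saturated_at_spaceE[OF KL(1,2)])
    obtain m where m: "m \<in> KS M" "L = \<eta> M m"
      by (rule compact_saturated_at_spaceE[OF KL(3,4)])
    have "K \<inter> L = \<eta> M (k \<sqinter> m)" using k m by (simp add: eta_meet)
    then show ?thesis using compactin_eta[OF sob KS] k m by simp
  qed
  then show ?thesis
    using sober_at_space[OF lc sob] neighbourhood_base_at_space[OF lc sob]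
    by (simp add: stably_locally_compact_space_def)
qed

end

section \<open>The powerset algebra of a space\<close>

lemma Pw_simps [simp]:
  "carrier (Pw X) = Pow (topspace X)"
  "A \<sqsubseteq>\<^bsub>Pw X\<^esub> B \<longleftrightarrow> A \<subseteq> B"
  "A .=\<^bsub>Pw X\<^esub> B \<longleftrightarrow> A = B"
  "\<box>\<^bsub>Pw X\<^esub> A = X interior_of A"
  by (simp_all add: Pw_def)

lemma complete_lattice_Pw: "complete_lattice (Pw X)"
proof -
  interpret partial_order "Pw X" by unfold_locales (auto simp: fun_eq_iff)
  show ?thesis
  proof
    fix S assume S: "S \<subseteq> carrier (Pw X)"
    have "least (Pw X) (\<Union>S) (Upper (Pw X) S)"
      using S by (auto simp: least_def Upper_def subset_iff Ball_def)
    then show "\<exists>s. least (Pw X) s (Upper (Pw X) S)" by blast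
    have "greatest (Pw X) (topspace X \<inter> \<Inter>S) (Lower (Pw X) S)"
      using S by (auto simp: greatest_def Lower_def) blast
    then show "\<exists>i. greatest (Pw X) i (Lower (Pw X) S)" by blast
  qed
qed

lemma sup_Pw [simp]:
  assumes "S \<subseteq> Pow (topspace X)"
  shows "\<Squnion>\<^bsub>Pw X\<^esub> S = \<Union>S"
proof -
  interpret complete_lattice "Pw X" by (rule complete_lattice_Pw)
  show ?thesis
  proof (rule equalityI)
    have "\<Squnion>\<^bsub>Pw X\<^esub> S \<sqsubseteq>\<^bsub>Pw X\<^esub> \<Union>S" using assms by (intro sup_least) auto
    then show "\<Squnion>\<^bsub>Pw X\<^esub> S \<subseteq> \<Union>S" by simp
    show "\<Union>S \<subseteq> \<Squnion>\<^bsub>Pw X\<^esub> S" using sup_upper[of S] assms by (simp add: Union_least)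
  qed
qed

lemma inf_Pw [simp]:
  assumes "S \<subseteq> Pow (topspace X)"
  shows "\<Sqinter>\<^bsub>Pw X\<^esub> S = topspace X \<inter> \<Inter>S"
proof -
  interpret complete_lattice "Pw X" by (rule complete_lattice_Pw)
  show ?thesis
    using inf_lower[of S] inf_greatest[of S "topspace X \<inter> \<Inter>S"] inf_closed[of S] assms by auto
qed

lemma
  assumes "A \<subseteq> topspace X" "B \<subseteq> topspace X"
  shows join_Pw [simp]: "A \<squnion>\<^bsub>Pw X\<^esub> B = A \<union> B"
    and meet_Pw [simp]: "A \<sqinter>\<^bsub>Pw X\<^esub> B = A \<inter> B"
  using assms by (auto simp: join_def meet_def)

lemma
  shows bottom_Pw [simp]: "\<bottom>\<^bsub>Pw X\<^esub> = {}"
    and top_Pw [simp]: "\<top>\<^bsub>Pw X\<^esub> = topspace X"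
proof -
  interpret complete_lattice "Pw X" by (rule complete_lattice_Pw)
  show "\<bottom>\<^bsub>Pw X\<^esub> = {}" "\<top>\<^bsub>Pw X\<^esub> = topspace X"
    using bottom_lower[of "{}"] top_higher[of "topspace X"] top_closed by auto
qed

lemma mt_algebra_Pw: "mt_algebra (Pw X)"
proof -
  interpret complete_lattice "Pw X" by (rule complete_lattice_Pw)
  show ?thesis
  proof
    fix A assume A: "A \<in> carrier (Pw X)"
    then have "topspace X - A \<in> carrier (Pw X)" "A \<sqinter>\<^bsub>Pw X\<^esub> (topspace X - A) = \<bottom>\<^bsub>Pw X\<^esub>"
        "A \<squnion>\<^bsub>Pw X\<^esub> (topspace X - A) = \<top>\<^bsub>Pw X\<^esub>" by auto
    then show "\<exists>y\<in>carrier (Pw X). A \<sqinter>\<^bsub>Pw X\<^esub> y = \<bottom>\<^bsub>Pw X\<^esub> \<and> A \<squnion>\<^bsub>Pw X\<^esub> y = \<top>\<^bsub>Pw X\<^esub>" by blast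
  next
    fix x y z assume "x \<in> carrier (Pw X)" "y \<in> carrier (Pw X)" "z \<in> carrier (Pw X)"
    then have "x \<subseteq> topspace X" "y \<subseteq> topspace X" "z \<subseteq> topspace X" "y \<union> z \<subseteq> topspace X"
        "x \<inter> y \<subseteq> topspace X" "x \<inter> z \<subseteq> topspace X" by auto
    then show "x \<sqinter>\<^bsub>Pw X\<^esub> (y \<squnion>\<^bsub>Pw X\<^esub> z) = (x \<sqinter>\<^bsub>Pw X\<^esub> y) \<squnion>\<^bsub>Pw X\<^esub> (x \<sqinter>\<^bsub>Pw X\<^esub> z)"
      by (simp add: Int_Un_distrib)
  qed (auto simp: interior_of_subset_topspace interior_of_subset interior_of_Int
      dest: subsetD[OF interior_of_subset] subsetD[OF interior_of_subset_topspace])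
qed

interpretation Pw: mt_algebra "Pw X" for X
  by (rule mt_algebra_Pw)

section \<open>Dictionary between \<open>Pw X\<close> and the space \<open>X\<close>\<close>

lemma compl_Pw [simp]: "A \<subseteq> topspace X \<Longrightarrow> \<sim>\<^bsub>Pw X\<^esub> A = topspace X - A"
  by (rule Pw.compl_eqI) auto

lemma opens_Pw [simp]: "opens (Pw X) = {U. openin X U}"
  unfolding opens_def by (auto simp: interior_of_eq dest: openin_subset) (metis interior_of_eq)+

lemma closeds_Pw [simp]: "closeds (Pw X) = {C. closedin X C}"
  unfolding set_eq_iff Pw.closeds_iff by (auto simp: closedin_def)

lemma dia_Pw [simp]: "A \<subseteq> topspace X \<Longrightarrow> \<diamond>\<^bsub>Pw X\<^esub> A = X closure_of A"
  by (simp add: dia_def interior_of_subset_topspace closure_of_interior_of)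

lemma saturateds_Pw [simp]: "saturateds (Pw X) = {A. saturatedin X A}"
proof -
  have "\<Sqinter>\<^bsub>Pw X\<^esub> S = topspace X \<inter> \<Inter>S" if "\<forall>U\<in>S. openin X U" for S
    using that by (intro inf_Pw) (auto dest: openin_subset)
  then have "A \<in> saturateds (Pw X) \<longleftrightarrow> saturatedin X A" for A
    unfolding saturateds_def saturatedin_def by (simp add: subset_iff) metis
  then show ?thesis by blast
qed

lemma compacts_Pw [simp]: "compacts (Pw X) = {K. compactin X K}"
proof -
  have sup: "\<Squnion>\<^bsub>Pw X\<^esub> S = \<Union>S" if "S \<subseteq> {U. openin X U}" for S
    using that by (intro sup_Pw) (auto dest: openin_subset)
  have "K \<in> compacts (Pw X) \<longleftrightarrow> compactin X K" for K
  proof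
    assume K: "K \<in> compacts (Pw X)"
    show "compactin X K"
      unfolding compactin_def
    proof (intro conjI allI impI)
      show "K \<subseteq> topspace X" using K by (simp add: compacts_def)
      fix S assume S: "Ball S (openin X) \<and> K \<subseteq> \<Union>S"
      then have "S \<subseteq> opens (Pw X)" "K \<sqsubseteq>\<^bsub>Pw X\<^esub> \<Squnion>\<^bsub>Pw X\<^esub> S" by (auto simp: sup subset_iff)
      with K obtain T where "T \<subseteq> S" "finite T" "K \<sqsubseteq>\<^bsub>Pw X\<^esub> \<Squnion>\<^bsub>Pw X\<^esub> T" by (rule Pw.compactE)
      moreover have "\<Squnion>\<^bsub>Pw X\<^esub> T = \<Union>T" using S \<open>T \<subseteq> S\<close> by (intro sup) blast
      ultimately show "\<exists>F. finite F \<and> F \<subseteq> S \<and> K \<subseteq> \<Union>F" by (intro exI[of _ T]) simp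
    qed
  next
    assume K: "compactin X K"
    have "\<exists>T\<subseteq>S. finite T \<and> K \<sqsubseteq>\<^bsub>Pw X\<^esub> \<Squnion>\<^bsub>Pw X\<^esub> T"
      if S: "S \<subseteq> opens (Pw X)" "K \<sqsubseteq>\<^bsub>Pw X\<^esub> \<Squnion>\<^bsub>Pw X\<^esub> S" for S
    proof -
      obtain F where F: "finite F" "F \<subseteq> S" "K \<subseteq> \<Union>F"
        using compactinD[OF K, of S] S sup[of S] by (auto simp: subset_iff)
      moreover have "\<Squnion>\<^bsub>Pw X\<^esub> F = \<Union>F" using F S by (intro sup) auto
      ultimately show ?thesis by (intro exI[of _ F]) simp
    qed
    then show "K \<in> compacts (Pw X)"
      using compactin_subset_topspace[OF K] unfolding compacts_def by auto
  qed
  then show ?thesis by blast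
qed

lemma KS_Pw [simp]: "KS (Pw X) = {K. compactin X K \<and> saturatedin X K}"
  by (auto simp: KS_def)

lemma atoms_Pw [simp]: "atoms (Pw X) = (\<lambda>x. {x}) ` topspace X"
proof (intro equalityI subsetI)
  fix A assume A: "A \<in> atoms (Pw X)"
  have c: "A \<subseteq> topspace X" "A \<noteq> {}" using Pw.atomD(1,2)[OF A] by simp_all
  then obtain x where x: "x \<in> A" by blast
  then have "{x} = A" using Pw.atomD(3)[OF A, of "{x}"] c by auto
  then show "A \<in> (\<lambda>x. {x}) ` topspace X" using c x by blast
next
  fix A assume "A \<in> (\<lambda>x. {x}) ` topspace X"
  then show "A \<in> atoms (Pw X)" unfolding atoms_def by auto
qed

lemma eta_Pw: "A \<subseteq> topspace X \<Longrightarrow> \<eta> (Pw X) A = (\<lambda>x. {x}) ` A"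
  by (auto simp: Pw.eta_eq)

lemma spatial_Pw: "spatial (Pw X)"
  by (auto simp: spatial_def mt_algebra_Pw)

section \<open>Sobriety, local compactness and stability of the powerset algebra\<close>

lemma irreducible_closedin_closure_of_point:
  assumes "x \<in> topspace X"
  shows "irreducible_closedin X (X closure_of {x})"
  unfolding irreducible_closedin_def
proof (intro conjI allI impI)
  have x: "x \<in> X closure_of {x}" using assms by (simp add: in_closure_of)
  then show "X closure_of {x} \<noteq> {}" by blast
  show "X closure_of {x} = A \<or> X closure_of {x} = B"
    if "closedin X A \<and> closedin X B \<and> X closure_of {x} = A \<union> B" for A B
    using that x closure_of_minimal[of "{x}" A X] closure_of_minimal[of "{x}" B X] by auto
qed simp

text \<open>Every set is the union of its points, and a point is the intersection of its saturation
  and its closure: a \<open>y\<close> in both has the same closure as \<open>x\<close>, so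
  uniqueness of generic points gives \<open>y = x\<close>.\<close>

lemma T0_algebra_Pw:
  assumes sob: "sober_space X"
  shows "T0_algebra (Pw X)"
  unfolding T0_algebra_def
proof (intro conjI ballI mt_algebra_Pw)
  have point: "{x} \<in> weakly_locally_closeds (Pw X)" if x: "x \<in> topspace X" for x
  proof -
    let ?s = "topspace X \<inter> \<Inter>{U. openin X U \<and> x \<in> U}" and ?c = "X closure_of {x}"
    have "y = x" if y: "y \<in> ?s" "y \<in> ?c" for y
    proof -
      have "x \<in> X closure_of {y}" using x y by (auto simp: in_closure_of)
      then have "X closure_of {y} = ?c"
        using y by (intro equalityI closure_of_minimal) auto
      moreover have "\<exists>!z. z \<in> topspace X \<and> ?c = X closure_of {z}"
        using sob irreducible_closedin_closure_of_point[OF x] by (simp add: sober_space_def)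
      ultimately show ?thesis using x y by blast
    qed
    then have "{x} = ?s \<inter> ?c" using x by (auto simp: in_closure_of)
    also have "\<dots> = ?s \<sqinter>\<^bsub>Pw X\<^esub> ?c" by (simp add: closure_of_subset_topspace)
    finally have "{x} = ?s \<sqinter>\<^bsub>Pw X\<^esub> ?c" .
    moreover have "saturatedin X ?s"
      unfolding saturatedin_def by (intro exI[of _ "{U. openin X U \<and> x \<in> U}"]) simp
    ultimately show ?thesis
      unfolding weakly_locally_closeds_def by (intro CollectI exI[of _ ?s] exI[of _ ?c]) simp
  qed
  fix A assume A: "A \<in> carrier (Pw X)"
  then have "A = \<Squnion>\<^bsub>Pw X\<^esub> ((\<lambda>x. {x}) ` A)" by (subst sup_Pw) auto
  moreover have "(\<lambda>x. {x}) ` A \<subseteq> weakly_locally_closeds (Pw X)" using point A by auto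
  ultimately show "\<exists>S\<subseteq>weakly_locally_closeds (Pw X). A = \<Squnion>\<^bsub>Pw X\<^esub> S" by blast
qed

lemma sober_Pw:
  assumes sob: "sober_space X"
  shows "sober_mt (Pw X)"
  unfolding sober_mt_def
proof (intro conjI ballI T0_algebra_Pw[OF sob])
  fix p assume p: "p \<in> join_irreducible_closeds (Pw X)"
  then have "irreducible_closedin X p"
    by (auto simp: join_irreducible_closeds_def irreducible_closedin_def closedin_subset)
  then obtain x where "x \<in> topspace X" "p = X closure_of {x}"
    using sob unfolding sober_space_def by blast
  then show "\<exists>x\<in>atoms (Pw X). p = \<diamond>\<^bsub>Pw X\<^esub> x" by auto
qed

lemma locally_compact_Pw:
  assumes "neighbourhood_base_of (compactin X) X"
  shows "locally_compact_mt (Pw X)"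
  unfolding locally_compact_mt_def
proof (intro conjI ballI mt_algebra_Pw)
  fix U assume "U \<in> opens (Pw X)"
  then have U: "openin X U" by simp
  let ?S = "{V. openin X V \<and> V \<lhd>\<^bsub>Pw X\<^esub> U}"
  have "\<exists>V. V \<in> ?S \<and> x \<in> V" if "x \<in> U" for x
    using assms U that unfolding neighbourhood_base_of by (simp add: compactly_below_def) meson
  moreover have "V \<subseteq> U" if "V \<in> ?S" for V using that by (auto simp: compactly_below_def)
  ultimately have "U = \<Union>?S" by blast
  also have "\<dots> = \<Squnion>\<^bsub>Pw X\<^esub> ?S" by (rule sup_Pw[symmetric]) (auto dest: openin_subset)
  finally show "U = \<Squnion>\<^bsub>Pw X\<^esub> {V \<in> opens (Pw X). V \<lhd>\<^bsub>Pw X\<^esub> U}" by simp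
qed

lemma saturatedin_subset: "saturatedin X A \<Longrightarrow> A \<subseteq> topspace X"
  by (auto simp: saturatedin_def)

lemma saturatedin_Int:
  assumes "saturatedin X A" "saturatedin X B"
  shows "saturatedin X (A \<inter> B)"
proof -
  obtain \<U> \<V> where "\<forall>U\<in>\<U>. openin X U" "A = topspace X \<inter> \<Inter>\<U>" "\<forall>U\<in>\<V>. openin X U" "B = topspace X \<inter> \<Inter>\<V>"
    using assms unfolding saturatedin_def by blast
  then show ?thesis unfolding saturatedin_def by (intro exI[of _ "\<U> \<union> \<V>"]) auto
qed

lemma stably_locally_compact_Pw:
  assumes "stably_locally_compact_space X"
  shows "stably_locally_compact_mt (Pw X)"
  using assms sober_Pw locally_compact_Pw
  unfolding stably_locally_compact_space_def stably_locally_compact_mt_def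
  by (auto simp: saturatedin_subset saturatedin_Int)

section \<open>Morphisms of algebras\<close>

lemma complete_boolean_homsD:
  assumes "f \<in> complete_boolean_homs L K"
  shows "f \<in> carrier L \<rightarrow>\<^sub>E carrier K"
    and "S \<subseteq> carrier L \<Longrightarrow> f (\<Squnion>\<^bsub>L\<^esub> S) = \<Squnion>\<^bsub>K\<^esub> (f ` S)"
    and "S \<subseteq> carrier L \<Longrightarrow> f (\<Sqinter>\<^bsub>L\<^esub> S) = \<Sqinter>\<^bsub>K\<^esub> (f ` S)"
    and "a \<in> carrier L \<Longrightarrow> f (\<sim>\<^bsub>L\<^esub> a) = \<sim>\<^bsub>K\<^esub> (f a)"
  using assms by (auto simp: complete_boolean_homs_def)

locale mt_morphism = dom: mt_algebra M + cod: mt_algebra N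
  for M :: "('a, 'y) mt_scheme" and N :: "('b, 'z) mt_scheme" +
  fixes f :: "'a \<Rightarrow> 'b"
  assumes morphism: "f \<in> mt_morphisms M N"
begin

lemma hom: "f \<in> complete_boolean_homs M N"
  using morphism by (simp add: mt_morphisms_def)

lemmas hom_extensional = complete_boolean_homsD(1)[OF hom]
  and hom_sup = complete_boolean_homsD(2)[OF hom]
  and hom_inf = complete_boolean_homsD(3)[OF hom]
  and hom_compl = complete_boolean_homsD(4)[OF hom]

lemma hom_closed [simp]: "a \<in> carrier M \<Longrightarrow> f a \<in> carrier N"
  using hom_extensional by auto

lemma hom_box: "a \<in> carrier M \<Longrightarrow> f (\<box>\<^bsub>M\<^esub> a) \<sqsubseteq>\<^bsub>N\<^esub> \<box>\<^bsub>N\<^esub> (f a)"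
  using morphism by (simp add: mt_morphisms_def)

lemma hom_mono:
  assumes "a \<in> carrier M" "b \<in> carrier M" "a \<sqsubseteq>\<^bsub>M\<^esub> b"
  shows "f a \<sqsubseteq>\<^bsub>N\<^esub> f b"
proof -
  have "\<Squnion>\<^bsub>M\<^esub> {a, b} = b" using assms dom.le_iff_meet[of a b] by (simp add: join_def)
  then have "f b = \<Squnion>\<^bsub>N\<^esub> {f a, f b}" using hom_sup[of "{a, b}"] assms by simp
  then show ?thesis using cod.sup_upper[of "{f a, f b}" "f a"] assms by simp
qed

lemma hom_bottom: "f \<bottom>\<^bsub>M\<^esub> = \<bottom>\<^bsub>N\<^esub>"
  using hom_sup[of "{}"] by simp

lemma hom_open: "u \<in> opens M \<Longrightarrow> f u \<in> opens N"
  using hom_box[of u] by (intro cod.opensI) (simp_all add: dom.box_of_open)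

lemma at_map_eq: "x \<in> atoms N \<Longrightarrow> at_map M N f x = \<Sqinter>\<^bsub>M\<^esub> {a \<in> carrier M. x \<sqsubseteq>\<^bsub>N\<^esub> f a}"
  by (simp add: at_map_def)

lemma at_map_carrier: "x \<in> atoms N \<Longrightarrow> at_map M N f x \<in> carrier M"
  by (simp add: at_map_eq)

lemma at_map_le_iff:
  assumes x: "x \<in> atoms N" and a: "a \<in> carrier M"
  shows "at_map M N f x \<sqsubseteq>\<^bsub>M\<^esub> a \<longleftrightarrow> x \<sqsubseteq>\<^bsub>N\<^esub> f a"
proof
  let ?S = "{a \<in> carrier M. x \<sqsubseteq>\<^bsub>N\<^esub> f a}"
  show "at_map M N f x \<sqsubseteq>\<^bsub>M\<^esub> a" if "x \<sqsubseteq>\<^bsub>N\<^esub> f a"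
    using that x a by (auto simp: at_map_eq intro!: dom.inf_lower)
  have "x \<sqsubseteq>\<^bsub>N\<^esub> \<Sqinter>\<^bsub>N\<^esub> (f ` ?S)" using x by (intro cod.inf_greatest) auto
  then have le: "x \<sqsubseteq>\<^bsub>N\<^esub> f (at_map M N f x)" using x hom_inf[of ?S] by (simp add: at_map_eq)
  show "x \<sqsubseteq>\<^bsub>N\<^esub> f a" if "at_map M N f x \<sqsubseteq>\<^bsub>M\<^esub> a"
    using le hom_mono[OF at_map_carrier a that] x a at_map_carrier
      cod.le_trans[of x "f (at_map M N f x)" "f a"] by simp
qed

text \<open>For \<open>y\<close> below \<open>at_map M N f x\<close>, the atom \<open>x\<close> lies
  below \<open>f y\<close> or below the image of the complement of \<open>y\<close>. By the
  adjunction \<open>y\<close> is then the whole element, or lies below its own complement and is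
  bottom.\<close>

lemma at_map_atom:
  assumes x: "x \<in> atoms N"
  shows "at_map M N f x \<in> atoms M"
proof -
  let ?p = "at_map M N f x"
  have p: "?p \<in> carrier M" using x by (rule at_map_carrier)
  have "?p \<noteq> \<bottom>\<^bsub>M\<^esub>"
    using at_map_le_iff[OF x, of "\<bottom>\<^bsub>M\<^esub>"] cod.atom_not_le_bot[OF x] hom_bottom by auto
  moreover have "y = \<bottom>\<^bsub>M\<^esub> \<or> y = ?p" if y: "y \<in> carrier M" "y \<sqsubseteq>\<^bsub>M\<^esub> ?p" for y
  proof (cases "x \<sqsubseteq>\<^bsub>N\<^esub> f y")
    case True
    then have "?p \<sqsubseteq>\<^bsub>M\<^esub> y" using x y by (simp add: at_map_le_iff)
    then show ?thesis using y p by (auto intro: dom.le_antisym)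
  next
    case False
    then have "x \<sqsubseteq>\<^bsub>N\<^esub> f (\<sim>\<^bsub>M\<^esub> y)" using x y by (simp add: hom_compl cod.atom_le_compl_iff)
    then have "?p \<sqsubseteq>\<^bsub>M\<^esub> \<sim>\<^bsub>M\<^esub> y" using x y by (simp add: at_map_le_iff)
    then have "y \<sqsubseteq>\<^bsub>M\<^esub> \<sim>\<^bsub>M\<^esub> y" using y p dom.le_trans[of y ?p "\<sim>\<^bsub>M\<^esub> y"] by simp
    then have "y \<sqinter>\<^bsub>M\<^esub> y = \<bottom>\<^bsub>M\<^esub>" using y by (simp add: dom.le_compl_iff)
    then show ?thesis using y dom.le_iff_join[of y y] by simp
  qed
  ultimately show ?thesis using p unfolding atoms_def by blast
qed

text \<open>The adjunction read on atoms: \<open>\<eta>\<close> turns \<open>f\<close> into taking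
  preimages under \<open>at_map M N f\<close>. Continuity, properness and naturality of
  \<open>\<eta>\<close> all rest on this identity.\<close>

lemma eta_hom:
  assumes "a \<in> carrier M"
  shows "\<eta> N (f a) = {x \<in> atoms N. at_map M N f x \<in> \<eta> M a}"
  using assms by (auto simp: dom.eta_eq cod.eta_eq at_map_le_iff at_map_atom)

lemma continuous_map_at_map: "continuous_map (at_space N) (at_space M) (at_map M N f)"
  unfolding continuous_map dom.topspace_at_space cod.topspace_at_space
proof (intro conjI allI impI)
  show "at_map M N f ` atoms N \<subseteq> atoms M" using at_map_atom by blast
  fix U assume "openin (at_space M) U"
  then obtain u where u: "u \<in> opens M" "U = \<eta> M u" by (auto simp: dom.openin_at_space)
  then have "{x \<in> atoms N. at_map M N f x \<in> U} = \<eta> N (f u)" by (simp add: eta_hom)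
  then show "openin (at_space N) {x \<in> atoms N. at_map M N f x \<in> U}"
    using hom_open u by (auto simp: cod.openin_at_space)
qed

text \<open>A compact saturated set of atoms of \<open>M\<close> is some \<open>\<eta> M k\<close>
  with \<open>k\<close> in \<open>KS M\<close>, and its preimage is \<open>\<eta> N (f k)\<close>,
  which is compact because \<open>f k\<close> is in \<open>KS N\<close> and \<open>N\<close> is
  sober.\<close>

lemma proper_at_map:
  assumes "sober_mt N" and proper: "\<And>k. k \<in> KS M \<Longrightarrow> f k \<in> KS N"
  shows "at_map M N f \<in> proper_maps (at_space N) (at_space M)"
  unfolding proper_maps_def mem_Collect_eq dom.topspace_at_space cod.topspace_at_space
proof (intro conjI allI impI continuous_map_at_map)
  show "at_map M N f \<in> atoms N \<rightarrow>\<^sub>E atoms M" using at_map_atom by (auto simp: at_map_def)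
  fix K assume K: "compactin (at_space M) K \<and> saturatedin (at_space M) K"
  obtain k where k: "k \<in> KS M" "K = \<eta> M k"
    by (rule dom.compact_saturated_at_spaceE[OF conjunct1[OF K] conjunct2[OF K]])
  then have "{x \<in> atoms N. at_map M N f x \<in> K} = \<eta> N (f k)" by (simp add: eta_hom)
  then show "compactin (at_space N) {x \<in> atoms N. at_map M N f x \<in> K}"
    using cod.compactin_eta assms k by simp
qed

end

section \<open>Identities and composites of algebra morphisms, functoriality of
  \<open>at\<close>\<close>

lemma mt_morphismI:
  "\<lbrakk>mt_algebra M; mt_algebra N; f \<in> mt_morphisms M N\<rbrakk> \<Longrightarrow> mt_morphism M N f"
  by (simp add: mt_morphism_def mt_morphism_axioms_def)

lemma (in complete_lattice) inf_above: "x \<in> carrier L \<Longrightarrow> \<Sqinter>{a \<in> carrier L. x \<sqsubseteq> a} = x"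
  by (intro le_antisym inf_lower inf_greatest) auto

lemma (in mt_algebra) mt_id_morphism: "mt_id M \<in> mt_morphisms M M"
proof -
  have "mt_id M ` S = S" if "S \<subseteq> carrier M" for S
    using that by (force simp: mt_id_def)
  then show ?thesis
    by (auto simp: mt_morphisms_def complete_boolean_homs_def mt_id_def box_closed)
qed

lemma (in mt_algebra) mt_id_proper: "mt_id M \<in> proper_mt_morphisms M M"
  using mt_id_morphism KS_carrier by (auto simp: proper_mt_morphisms_def mt_id_def)

lemma compose_mt_morphisms:
  assumes alg: "mt_algebra M" "mt_algebra N" "mt_algebra R"
    and f: "f \<in> mt_morphisms M N" and g: "g \<in> mt_morphisms N R"
  shows "compose (carrier M) g f \<in> mt_morphisms M R"
proof -
  interpret f: mt_morphism M N f using alg f by (intro mt_morphismI)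
  interpret g: mt_morphism N R g using alg g by (intro mt_morphismI)
  have c: "compose (carrier M) g f a = g (f a)" if "a \<in> carrier M" for a
    using that by (simp add: compose_def)
  have im: "compose (carrier M) g f ` S = g ` f ` S" "f ` S \<subseteq> carrier N" if "S \<subseteq> carrier M" for S
    using that by (auto simp: image_image c subset_iff intro!: image_cong)
  have "compose (carrier M) g f (\<box>\<^bsub>M\<^esub> a) \<sqsubseteq>\<^bsub>R\<^esub> \<box>\<^bsub>R\<^esub> (compose (carrier M) g f a)"
    if a: "a \<in> carrier M" for a
  proof -
    have "g (f (\<box>\<^bsub>M\<^esub> a)) \<sqsubseteq>\<^bsub>R\<^esub> g (\<box>\<^bsub>N\<^esub> (f a))"
      using a by (intro g.hom_mono f.hom_box) (simp_all add: f.dom.box_closed f.cod.box_closed)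
    also have "\<dots> \<sqsubseteq>\<^bsub>R\<^esub> \<box>\<^bsub>R\<^esub> (g (f a))" using a by (intro g.hom_box) simp
    finally show ?thesis using a by (simp add: c f.dom.box_closed f.cod.box_closed g.cod.box_closed)
  qed
  moreover have "compose (carrier M) g f \<in> complete_boolean_homs M R"
    unfolding complete_boolean_homs_def mem_Collect_eq
  proof (intro conjI ballI allI impI)
    show "compose (carrier M) g f \<in> carrier M \<rightarrow>\<^sub>E carrier R" by (auto simp: compose_def)
    fix S assume S: "S \<subseteq> carrier M"
    show "compose (carrier M) g f (\<Squnion>\<^bsub>M\<^esub> S) = \<Squnion>\<^bsub>R\<^esub> (compose (carrier M) g f ` S)"
         "compose (carrier M) g f (\<Sqinter>\<^bsub>M\<^esub> S) = \<Sqinter>\<^bsub>R\<^esub> (compose (carrier M) g f ` S)"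
      using S im[OF S] by (simp_all add: c f.hom_sup g.hom_sup f.hom_inf g.hom_inf)
  qed (simp add: c f.hom_compl g.hom_compl)
  ultimately show ?thesis by (simp add: mt_morphisms_def)
qed

lemma compose_proper_mt_morphisms:
  assumes "mt_algebra M" "mt_algebra N" "mt_algebra R"
    and "f \<in> proper_mt_morphisms M N" and "g \<in> proper_mt_morphisms N R"
  shows "compose (carrier M) g f \<in> proper_mt_morphisms M R"
proof -
  interpret M: mt_algebra M by fact
  show ?thesis
    using assms compose_mt_morphisms[of M N R f g] M.KS_carrier
    by (auto simp: proper_mt_morphisms_def compose_def)
qed

lemma at_map_compose:
  assumes alg: "mt_algebra M" "mt_algebra N" "mt_algebra R"
    and f: "f \<in> mt_morphisms M N" and g: "g \<in> mt_morphisms N R"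
  shows "at_map M R (compose (carrier M) g f) = compose (atoms R) (at_map M N f) (at_map N R g)"
proof
  interpret f: mt_morphism M N f using alg f by (intro mt_morphismI)
  interpret g: mt_morphism N R g using alg g by (intro mt_morphismI)
  interpret gf: mt_morphism M R "compose (carrier M) g f"
    using alg f g by (intro mt_morphismI compose_mt_morphisms)
  fix x
  show "at_map M R (compose (carrier M) g f) x = compose (atoms R) (at_map M N f) (at_map N R g) x"
  proof (cases "x \<in> atoms R")
    case x: True
    \<comment> \<open>Two elements with the same elements above them are equal, so it suffices to
      chain the adjunctions.\<close>
    have *: "at_map M R (compose (carrier M) g f) x \<sqsubseteq>\<^bsub>M\<^esub> a \<longleftrightarrow>
        at_map M N f (at_map N R g x) \<sqsubseteq>\<^bsub>M\<^esub> a" if "a \<in> carrier M" for a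
      using that x gf.at_map_le_iff[of x a]
      by (simp add: f.at_map_le_iff g.at_map_le_iff g.at_map_atom compose_eq)
    then show ?thesis
      using x gf.at_map_carrier[OF x] f.at_map_carrier[OF g.at_map_atom[OF x]]
      by (auto simp: compose_def intro!: f.dom.le_antisym)
  next
    case False
    then show ?thesis by (simp add: at_map_def compose_def)
  qed
qed

context mt_algebra
begin

lemma at_map_mt_id: "at_map M M (mt_id M) = space_id (at_space M)"
proof -
  have "{a \<in> carrier M. x \<sqsubseteq> mt_id M a} = {a \<in> carrier M. x \<sqsubseteq> a}" for x
    by (auto simp: mt_id_def)
  then show ?thesis
    by (auto simp: at_map_def space_id_def topspace_at_space inf_above)
qed

section \<open>The unit \<open>\<eta>\<close>\<close>

lemma eta_morphism: "\<eta> M \<in> mt_morphisms M (Pw (at_space M))"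
  unfolding mt_morphisms_def complete_boolean_homs_def mem_Collect_eq
proof (intro conjI ballI allI impI)
  show "\<eta> M \<in> carrier M \<rightarrow>\<^sub>E carrier (Pw (at_space M))"
    unfolding Pw_simps topspace_at_space
    by (rule PiE_I) (use eta_subset_atoms in \<open>simp_all add: \<eta>_def\<close>)
  fix S assume S: "S \<subseteq> carrier M"
  then have "\<eta> M ` S \<subseteq> Pow (topspace (at_space M))"
    using eta_subset_atoms by (auto simp: topspace_at_space)
  then show "\<eta> M (\<Squnion>S) = \<Squnion>\<^bsub>Pw (at_space M)\<^esub> (\<eta> M ` S)"
    "\<eta> M (\<Sqinter>S) = \<Sqinter>\<^bsub>Pw (at_space M)\<^esub> (\<eta> M ` S)"
    using S by (simp_all add: eta_sup eta_inf topspace_at_space)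
next
  fix a assume a: "a \<in> carrier M"
  show "\<eta> M (\<sim> a) = \<sim>\<^bsub>Pw (at_space M)\<^esub> (\<eta> M a)"
    using a by (simp add: eta_compl eta_subset_atoms topspace_at_space)
  have "at_space M interior_of (\<eta> M a) \<supseteq> \<eta> M (\<box> a)"
    using a by (intro interior_of_maximal) (auto simp: eta_mono box_closed box_le openin_at_space)
  then show "\<eta> M (\<box> a) \<sqsubseteq>\<^bsub>Pw (at_space M)\<^esub> \<box>\<^bsub>Pw (at_space M)\<^esub> (\<eta> M a)" by simp
qed

lemma eta_proper:
  assumes "sober_mt M"
  shows "\<eta> M \<in> proper_mt_morphisms M (Pw (at_space M))"
  using assms eta_morphism compactin_eta saturatedin_eta
  by (auto simp: proper_mt_morphisms_def KS_def[of M])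

lemma at_map_eta:
  assumes "x \<in> atoms M"
  shows "at_map M (Pw (at_space M)) (\<eta> M) {x} = x"
proof -
  have "{a \<in> carrier M. {x} \<sqsubseteq>\<^bsub>Pw (at_space M)\<^esub> \<eta> M a} = {a \<in> carrier M. x \<sqsubseteq> a}"
    using assms by (auto simp: eta_eq)
  then show ?thesis
    using assms by (simp add: at_map_def topspace_at_space inf_above)
qed

lemma eta_sup_atoms: "A \<subseteq> atoms M \<Longrightarrow> \<eta> M (\<Squnion>A) = A"
  by (subst eta_sup) (auto simp: eta_atom subset_iff)

text \<open>An atom below the difference of \<open>a\<close> and
  \<open>\<Squnion>(\<eta> M a)\<close> would be below \<open>a\<close>, hence one of the joined
  atoms, and also below the complement of the join.\<close>

lemma sup_eta:
  assumes sp: "spatial M" and a: "a \<in> carrier M"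
  shows "\<Squnion>(\<eta> M a) = a"
proof (rule le_antisym)
  have c: "\<eta> M a \<subseteq> carrier M" using eta_subset_atoms[OF a] by auto
  then show sc: "\<Squnion>(\<eta> M a) \<in> carrier M" by simp
  show "\<Squnion>(\<eta> M a) \<sqsubseteq> a" using a c by (intro sup_least) (auto simp: eta_eq)
  let ?d = "a \<sqinter> \<sim> \<Squnion>(\<eta> M a)"
  have "?d = \<bottom>"
  proof (rule ccontr)
    assume "?d \<noteq> \<bottom>"
    then obtain x where x: "x \<in> atoms M" "x \<sqsubseteq> ?d" using sp a sc by (auto simp: spatial_def)
    then have "x \<sqsubseteq> a" "x \<sqsubseteq> \<sim> \<Squnion>(\<eta> M a)" using a sc by (simp_all add: le_meet_iff)
    moreover have "x \<sqsubseteq> \<Squnion>(\<eta> M a)" using c x a \<open>x \<sqsubseteq> a\<close> by (intro sup_upper) (auto simp: eta_eq)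
    ultimately show False using x sc by (simp add: atom_le_compl_iff)
  qed
  then show "a \<sqsubseteq> \<Squnion>(\<eta> M a)" using a sc le_compl_iff[of a "\<sim> \<Squnion>(\<eta> M a)"] by simp
qed (rule a)

lemma eta_iso:
  assumes sp: "spatial M" and sob: "sober_mt M"
  shows "mt_iso M (Pw (at_space M)) (\<eta> M)"
proof -
  let ?P = "Pw (at_space M)"
  define g where "g = (\<lambda>A\<in>Pow (atoms M). \<Squnion>A)"
  have cP: "carrier ?P = Pow (atoms M)" by (simp add: topspace_at_space)
  have g: "g A \<in> carrier M" "\<eta> M (g A) = A" if "A \<subseteq> atoms M" for A
    using that eta_sup_atoms[of A] by (auto simp: g_def subset_iff)
  have ge: "g (\<eta> M a) = a" if "a \<in> carrier M" for a
    using that eta_subset_atoms[of a] sup_eta[OF sp, of a] by (simp add: g_def)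
  \<comment> \<open>Spatiality makes \<open>\<eta>\<close> injective on all elements, and
    \<open>\<eta>\<close> preserves joins, meets and complements. Each law for \<open>g\<close> is
    therefore checked after applying \<open>\<eta>\<close>, where it becomes an identity of
    sets.\<close>
  have eqI: "a = b" if "a \<in> carrier M" "b \<in> carrier M" "\<eta> M a = \<eta> M b" for a b
    using that ge by metis
  have "g \<in> complete_boolean_homs ?P M"
    unfolding complete_boolean_homs_def mem_Collect_eq cP
  proof (intro conjI ballI allI impI)
    show "g \<in> Pow (atoms M) \<rightarrow>\<^sub>E carrier M" using g by (auto simp: g_def)
    fix S assume S: "S \<subseteq> Pow (atoms M)"
    then have S': "S \<subseteq> Pow (topspace (at_space M))" by (simp add: topspace_at_space)
    have gS: "g ` S \<subseteq> carrier M" using S g(1) by auto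
    have im: "\<eta> M ` g ` S = S" using S g(2) by (auto simp: image_image subset_iff)
    have U: "\<Union>S \<subseteq> atoms M" "atoms M \<inter> \<Inter>S \<subseteq> atoms M" using S by auto
    show "g (\<Squnion>\<^bsub>?P\<^esub> S) = \<Squnion>(g ` S)" unfolding sup_Pw[OF S']
      using U gS by (intro eqI g) (simp_all add: eta_sup im g)
    show "g (\<Sqinter>\<^bsub>?P\<^esub> S) = \<Sqinter>(g ` S)" unfolding inf_Pw[OF S'] topspace_at_space
      using U gS by (intro eqI g) (simp_all add: eta_inf im g)
  next
    fix A assume A: "A \<in> Pow (atoms M)"
    then have "g (atoms M - A) = \<sim> g A" by (intro eqI g) (auto simp: g eta_compl)
    then show "g (\<sim>\<^bsub>?P\<^esub> A) = \<sim> g A" using A by (simp add: topspace_at_space)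
  qed
  moreover have "g (\<box>\<^bsub>?P\<^esub> A) \<sqsubseteq> \<box> (g A)" if "A \<in> carrier ?P" for A
  proof -
    have A: "A \<subseteq> atoms M" using that by (simp add: topspace_at_space)
    \<comment> \<open>The interior of \<open>A\<close> is \<open>\<eta> M u\<close> for an open
      \<open>u\<close>. Spatiality gives
      \<open>u = \<Squnion>(\<eta> M u) \<sqsubseteq> g A\<close>, and an open element below
      \<open>g A\<close> is below its box.\<close>
    have "openin (at_space M) (at_space M interior_of A)" by simp
    then obtain u where u: "u \<in> opens M" "at_space M interior_of A = \<eta> M u"
      unfolding openin_at_space by blast
    have Ac: "A \<subseteq> carrier M" using A by auto
    have "\<eta> M u \<subseteq> A" using u interior_of_subset by metis
    then have "\<Squnion>(\<eta> M u) \<sqsubseteq> \<Squnion>A" using Ac by (rule sup_mono)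
    then have "u \<sqsubseteq> g A" using sup_eta[OF sp, of u] u A by (simp add: g_def)
    then have "u \<sqsubseteq> \<box> (g A)" using u g(1)[OF A] by (intro le_box)
    then show ?thesis using u ge by simp
  qed
  ultimately have gm: "g \<in> mt_morphisms ?P M" by (simp add: mt_morphisms_def)
  \<comment> \<open>Compact saturated sets come from \<open>KS M\<close> under
    \<open>\<eta>\<close>, so \<open>g\<close> recovers the element they come from.\<close>
  have "g K \<in> KS M" if "K \<in> KS ?P" for K
  proof -
    have "compactin (at_space M) K" "saturatedin (at_space M) K" using that by simp_all
    then obtain k where "k \<in> KS M" "K = \<eta> M k" by (rule compact_saturated_at_spaceE)
    then show ?thesis using ge by simp
  qed
  with gm have "g \<in> proper_mt_morphisms ?P M" by (simp add: proper_mt_morphisms_def)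
  moreover have "compose (carrier M) g (\<eta> M) = mt_id M"
    by (auto simp: compose_def mt_id_def ge)
  moreover have "compose (carrier ?P) (\<eta> M) g = mt_id ?P"
    unfolding compose_def mt_id_def cP by (rule restrict_ext) (simp add: g)
  ultimately show ?thesis unfolding mt_iso_def using eta_proper[OF sob] by blast
qed

end

section \<open>Maps of spaces\<close>

text \<open>Properness asks only for compactness of preimages; their saturation comes from
  continuity. Both together let proper maps compose and make \<open>Pw_map\<close> preserve
  \<open>KS\<close>.\<close>

lemma saturatedin_continuous_preimage:
  assumes "continuous_map X Y f" "saturatedin Y K"
  shows "saturatedin X {x \<in> topspace X. f x \<in> K}"
proof -
  obtain \<U> where U: "\<forall>U\<in>\<U>. openin Y U" "K = topspace Y \<inter> \<Inter>\<U>"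
    using assms(2) unfolding saturatedin_def by blast
  have "{x \<in> topspace X. f x \<in> K} = topspace X \<inter> \<Inter>((\<lambda>U. {x \<in> topspace X. f x \<in> U}) ` \<U>)"
    using U(2) continuous_map_image_subset_topspace[OF assms(1)] by auto
  moreover have "\<forall>V\<in>(\<lambda>U. {x \<in> topspace X. f x \<in> U}) ` \<U>. openin X V"
    using U(1) assms(1) by (auto simp: continuous_map)
  ultimately show ?thesis unfolding saturatedin_def by blast
qed

lemma space_id_proper: "space_id X \<in> proper_maps X X"
proof -
  have "{x \<in> topspace X. space_id X x \<in> K} = K" if "compactin X K" for K
    using compactin_subset_topspace[OF that] by (auto simp: space_id_def)
  moreover have "continuous_map X X (space_id X)"
    by (rule continuous_map_eq[OF continuous_map_id]) (simp add: space_id_def)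
  ultimately show ?thesis by (auto simp: proper_maps_def space_id_def)
qed

lemma compose_proper_maps:
  assumes f: "f \<in> proper_maps X Y" and g: "g \<in> proper_maps Y Z"
  shows "compose (topspace X) g f \<in> proper_maps X Z"
proof -
  have fc: "continuous_map X Y f" and gc: "continuous_map Y Z g"
    and fE: "f \<in> topspace X \<rightarrow>\<^sub>E topspace Y" and gE: "g \<in> topspace Y \<rightarrow>\<^sub>E topspace Z"
    using f g by (auto simp: proper_maps_def)
  have "continuous_map X Z (compose (topspace X) g f)"
    by (rule continuous_map_eq[OF continuous_map_compose[OF fc gc]]) (simp add: compose_def)
  moreover have "compactin X {x \<in> topspace X. compose (topspace X) g f x \<in> K}"
    if K: "compactin Z K" "saturatedin Z K" for K
  proof -
    let ?L = "{y \<in> topspace Y. g y \<in> K}"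
    have "compactin Y ?L" "saturatedin Y ?L"
      using K g saturatedin_continuous_preimage[OF gc] by (auto simp: proper_maps_def)
    then have "compactin X {x \<in> topspace X. f x \<in> ?L}"
      using f unfolding proper_maps_def by blast
    moreover have "{x \<in> topspace X. f x \<in> ?L} = {x \<in> topspace X. compose (topspace X) g f x \<in> K}"
      using fE by (auto simp: compose_def)
    ultimately show ?thesis by simp
  qed
  moreover have "compose (topspace X) g f \<in> topspace X \<rightarrow>\<^sub>E topspace Z"
    using fE gE by (auto simp: compose_def)
  ultimately show ?thesis by (simp add: proper_maps_def)
qed

lemma compose_restrict_id:
  assumes "f \<in> A \<rightarrow>\<^sub>E B"
  shows "compose A f (\<lambda>x\<in>A. x) = f" "compose A (\<lambda>y\<in>B. y) f = f"
  using assms by (auto simp: compose_def fun_eq_iff PiE_def extensional_def)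

section \<open>Functoriality of \<open>Pw\<close>\<close>

lemma Pw_map_eq: "B \<subseteq> topspace Y \<Longrightarrow> Pw_map X Y f B = {x \<in> topspace X. f x \<in> B}"
  by (simp add: Pw_map_def)

lemma Pw_map_morphism:
  assumes f: "continuous_map X Y f"
  shows "Pw_map X Y f \<in> mt_morphisms (Pw Y) (Pw X)"
  unfolding mt_morphisms_def complete_boolean_homs_def mem_Collect_eq Pw_simps
proof (intro conjI ballI allI impI)
  have fY: "f x \<in> topspace Y" if "x \<in> topspace X" for x
    using that continuous_map_image_subset_topspace[OF f] by auto
  show "Pw_map X Y f \<in> Pow (topspace Y) \<rightarrow>\<^sub>E Pow (topspace X)" by (auto simp: Pw_map_def)
  fix S assume S: "S \<subseteq> Pow (topspace Y)"
  have im: "Pw_map X Y f ` S = (\<lambda>B. {x \<in> topspace X. f x \<in> B}) ` S"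
    using S by (intro image_cong) (auto simp: Pw_map_eq)
  have S': "\<Union>S \<subseteq> topspace Y" "topspace Y \<inter> \<Inter>S \<subseteq> topspace Y"
    "(\<lambda>B. {x \<in> topspace X. f x \<in> B}) ` S \<subseteq> Pow (topspace X)" using S by auto
  show "Pw_map X Y f (\<Squnion>\<^bsub>Pw Y\<^esub> S) = \<Squnion>\<^bsub>Pw X\<^esub> (Pw_map X Y f ` S)"
    unfolding im sup_Pw[OF S] sup_Pw[OF S'(3)] Pw_map_eq[OF S'(1)] by auto
  show "Pw_map X Y f (\<Sqinter>\<^bsub>Pw Y\<^esub> S) = \<Sqinter>\<^bsub>Pw X\<^esub> (Pw_map X Y f ` S)"
    unfolding im inf_Pw[OF S] inf_Pw[OF S'(3)] Pw_map_eq[OF S'(2)] using fY by auto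
next
  fix B assume "B \<in> Pow (topspace Y)"
  then have B: "B \<subseteq> topspace Y" by simp
  have c: "{x \<in> topspace X. f x \<in> B} \<subseteq> topspace X" by auto
  show "Pw_map X Y f (\<sim>\<^bsub>Pw Y\<^esub> B) = \<sim>\<^bsub>Pw X\<^esub> (Pw_map X Y f B)"
    unfolding Pw_map_eq[OF B] compl_Pw[OF B] compl_Pw[OF c] Pw_map_eq[OF Diff_subset]
    using continuous_map_image_subset_topspace[OF f] by auto
  \<comment> \<open>Continuity makes the preimage of the interior an open subset of the preimage of
    \<open>B\<close>, which is the inequality required of the box.\<close>
  have "openin X {x \<in> topspace X. f x \<in> Y interior_of B}"
    using f by (simp add: continuous_map)
  then show "Pw_map X Y f (Y interior_of B) \<subseteq> X interior_of (Pw_map X Y f B)"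
    using interior_of_subset[of Y B] unfolding Pw_map_eq[OF B] Pw_map_eq[OF interior_of_subset_topspace]
    by (intro interior_of_maximal) auto
qed

lemma Pw_map_proper:
  assumes "f \<in> proper_maps X Y"
  shows "Pw_map X Y f \<in> proper_mt_morphisms (Pw Y) (Pw X)"
proof -
  have "continuous_map X Y f" using assms by (simp add: proper_maps_def)
  then show ?thesis
    using assms Pw_map_morphism saturatedin_continuous_preimage
    by (auto simp: proper_mt_morphisms_def proper_maps_def Pw_map_eq saturatedin_subset)
qed

lemma Pw_map_space_id: "Pw_map X X (space_id X) = mt_id (Pw X)"
  by (auto simp: Pw_map_def mt_id_def space_id_def fun_eq_iff)

lemma Pw_map_compose:
  assumes "f \<in> topspace X \<rightarrow>\<^sub>E topspace Y"
  shows "Pw_map X Z (compose (topspace X) g f) =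
    compose (carrier (Pw Z)) (Pw_map X Y f) (Pw_map Y Z g)"
proof
  fix C
  show "Pw_map X Z (compose (topspace X) g f) C =
    compose (carrier (Pw Z)) (Pw_map X Y f) (Pw_map Y Z g) C"
  proof (cases "C \<subseteq> topspace Z")
    case True
    have "{y \<in> topspace Y. g y \<in> C} \<subseteq> topspace Y" by auto
    then show ?thesis using True assms by (auto simp: Pw_map_eq compose_def)
  qed (simp add: Pw_map_def compose_def)
qed

section \<open>The unit \<open>\<epsilon>\<close>, naturality and the triangle identities\<close>

lemma topspace_at_space_Pw: "topspace (at_space (Pw X)) = (\<lambda>x. {x}) ` topspace X"
  by (simp add: Pw.topspace_at_space)

text \<open>All open and all compact saturated sets of \<open>at_space (Pw X)\<close> have the form
  \<open>\<eta> (Pw X) A\<close>, so this one preimage gives continuity and properness of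
  \<open>\<epsilon> X\<close>, and also a triangle identity.\<close>

lemma preimage_epsilon:
  "A \<subseteq> topspace X \<Longrightarrow> {x \<in> topspace X. \<epsilon> X x \<in> \<eta> (Pw X) A} = A"
  by (auto simp: \<epsilon>_def eta_Pw)

lemma epsilon_proper: "\<epsilon> X \<in> proper_maps X (at_space (Pw X))"
  unfolding proper_maps_def mem_Collect_eq
proof (intro conjI allI impI)
  show "\<epsilon> X \<in> topspace X \<rightarrow>\<^sub>E topspace (at_space (Pw X))"
    by (auto simp: topspace_at_space_Pw \<epsilon>_def)
  show "continuous_map X (at_space (Pw X)) (\<epsilon> X)"
    unfolding continuous_map
  proof (intro conjI allI impI)
    show "\<epsilon> X ` topspace X \<subseteq> topspace (at_space (Pw X))"
      by (auto simp: topspace_at_space_Pw \<epsilon>_def)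
    fix U assume "openin (at_space (Pw X)) U"
    then obtain A where "openin X A" "U = \<eta> (Pw X) A" by (auto simp: Pw.openin_at_space)
    then show "openin X {x \<in> topspace X. \<epsilon> X x \<in> U}"
      by (simp add: preimage_epsilon openin_subset)
  qed
  fix K assume "compactin (at_space (Pw X)) K \<and> saturatedin (at_space (Pw X)) K"
  then have "compactin (at_space (Pw X)) K" "saturatedin (at_space (Pw X)) K" by auto
  then obtain A where "A \<in> KS (Pw X)" "K = \<eta> (Pw X) A" by (rule Pw.compact_saturated_at_spaceE)
  then show "compactin X {x \<in> topspace X. \<epsilon> X x \<in> K}"
    by (simp add: preimage_epsilon saturatedin_subset)
qed

lemma epsilon_iso:
  assumes sob: "sober_space X"
  shows "space_iso X (at_space (Pw X)) (\<epsilon> X)"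
proof -
  \<comment> \<open>The points of \<open>at_space (Pw X)\<close> are singletons, and
    \<open>the_elem\<close> reads off their element.\<close>
  define g where "g = (\<lambda>A\<in>topspace (at_space (Pw X)). the_elem A)"
  have pre: "{A \<in> topspace (at_space (Pw X)). g A \<in> B} = \<eta> (Pw X) B" if "B \<subseteq> topspace X" for B
    using that by (auto simp: g_def topspace_at_space_Pw eta_Pw)
  have "g \<in> proper_maps (at_space (Pw X)) X"
    unfolding proper_maps_def mem_Collect_eq
  proof (intro conjI allI impI)
    show "g \<in> topspace (at_space (Pw X)) \<rightarrow>\<^sub>E topspace X"
      by (auto simp: topspace_at_space_Pw g_def)
    show "continuous_map (at_space (Pw X)) X g"
      unfolding continuous_map
      by (auto simp: pre openin_subset Pw.openin_at_space) (auto simp: topspace_at_space_Pw g_def)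
    fix K assume "compactin X K \<and> saturatedin X K"
    \<comment> \<open>Sobriety of \<open>X\<close> enters here: it makes \<open>Pw X\<close> sober,
      which gives compactness of \<open>\<eta> (Pw X) K\<close>.\<close>
    then show "compactin (at_space (Pw X)) {A \<in> topspace (at_space (Pw X)). g A \<in> K}"
      using Pw.compactin_eta[OF sober_Pw[OF sob], of K] by (simp add: pre saturatedin_subset)
  qed
  moreover have "compose (topspace X) g (\<epsilon> X) = space_id X"
    by (auto simp: compose_def space_id_def g_def \<epsilon>_def topspace_at_space_Pw)
  moreover have "compose (topspace (at_space (Pw X))) (\<epsilon> X) g = space_id (at_space (Pw X))"
    unfolding compose_def space_id_def
    by (rule restrict_ext) (auto simp: g_def \<epsilon>_def topspace_at_space_Pw)
  ultimately show ?thesis unfolding space_iso_def using epsilon_proper by blast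
qed

lemma epsilon_natural:
  assumes f: "f \<in> topspace X \<rightarrow>\<^sub>E topspace Y"
  shows "compose (topspace X) (at_map (Pw Y) (Pw X) (Pw_map X Y f)) (\<epsilon> X) =
    compose (topspace X) (\<epsilon> Y) f"
  unfolding compose_def
proof (rule restrict_ext)
  fix x assume x: "x \<in> topspace X"
  then have fx: "f x \<in> topspace Y" using f by auto
  \<comment> \<open>The atom \<open>{x}\<close> goes to the intersection of all \<open>B\<close>
    with \<open>f x \<in> B\<close>, which is \<open>{f x}\<close>.\<close>
  have "{B \<in> carrier (Pw Y). {x} \<sqsubseteq>\<^bsub>Pw X\<^esub> Pw_map X Y f B} = {B \<in> Pow (topspace Y). f x \<in> B}"
    using x by (auto simp: Pw_map_eq)
  moreover have "\<Sqinter>\<^bsub>Pw Y\<^esub> {B \<in> Pow (topspace Y). f x \<in> B} = {f x}"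
    using fx by (subst inf_Pw) auto
  ultimately show "at_map (Pw Y) (Pw X) (Pw_map X Y f) (\<epsilon> X x) = \<epsilon> Y (f x)"
    using x fx by (simp add: at_map_def \<epsilon>_def)
qed

lemma triangle_Pw:
  "compose (carrier (Pw X)) (Pw_map X (at_space (Pw X)) (\<epsilon> X)) (\<eta> (Pw X)) = mt_id (Pw X)"
  unfolding compose_def mt_id_def
proof (rule restrict_ext)
  fix A assume A: "A \<in> carrier (Pw X)"
  then have "\<eta> (Pw X) A \<subseteq> topspace (at_space (Pw X))"
    using Pw.eta_subset_atoms Pw.topspace_at_space by metis
  then show "Pw_map X (at_space (Pw X)) (\<epsilon> X) (\<eta> (Pw X) A) = A"
    using A by (simp add: Pw_map_eq preimage_epsilon)
qed

lemma (in mt_algebra) triangle_at: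
  "compose (topspace (at_space M)) (at_map M (Pw (at_space M)) (\<eta> M)) (\<epsilon> (at_space M)) =
   space_id (at_space M)"
  unfolding compose_def space_id_def
  by (rule restrict_ext) (simp add: \<epsilon>_def topspace_at_space at_map_eta)

lemma (in mt_morphism) eta_natural:
  "compose (carrier M) (Pw_map (at_space N) (at_space M) (at_map M N f)) (\<eta> M) =
   compose (carrier M) (\<eta> N) f"
  unfolding compose_def
proof (rule restrict_ext)
  fix a assume a: "a \<in> carrier M"
  then have "\<eta> M a \<subseteq> topspace (at_space M)"
    by (simp add: dom.topspace_at_space dom.eta_subset_atoms)
  then show "Pw_map (at_space N) (at_space M) (at_map M N f) (\<eta> M a) = \<eta> N (f a)"
    using a by (simp add: Pw_map_eq cod.topspace_at_space eta_hom)
qed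

section \<open>Objects and morphisms of the categories\<close>

lemma StLCMT_D:
  assumes "M \<in> StLCMT"
  shows "mt_algebra M" "sober_mt M" "stably_locally_compact_mt M"
  using assms
  by (auto simp: StLCMT_def stably_locally_compact_mt_def sober_mt_def T0_algebra_def)

lemma StLCSob_sober: "X \<in> StLCSob \<Longrightarrow> sober_space X"
  by (simp add: StLCSob_def stably_locally_compact_space_def)

lemma Pw_StLCSMT: "X \<in> StLCSob \<Longrightarrow> Pw X \<in> StLCSMT"
  by (simp add: StLCSob_def StLCSMT_def StLCMT_def stably_locally_compact_Pw spatial_Pw)

lemma at_space_StLCSob: "M \<in> StLCMT \<Longrightarrow> at_space M \<in> StLCSob"
  using mt_algebra.stably_locally_compact_at_space[OF StLCMT_D(1,3)] by (simp add: StLCSob_def)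

lemma proper_mapsD: "f \<in> proper_maps X Y \<Longrightarrow> f \<in> topspace X \<rightarrow>\<^sub>E topspace Y"
  by (simp add: proper_maps_def)

lemma proper_mt_morphismsD:
  assumes "f \<in> proper_mt_morphisms M N"
  shows "f \<in> mt_morphisms M N" "f \<in> carrier M \<rightarrow>\<^sub>E carrier N" "k \<in> KS M \<Longrightarrow> f k \<in> KS N"
  using assms by (auto simp: proper_mt_morphisms_def mt_morphisms_def complete_boolean_homs_def)

text \<open>The dual adjunction is given by its units and triangle identities. As \<open>Pw\<close>
  takes values in \<open>StLCSMT\<close>, which has the hom-sets of \<open>StLCMT\<close>,
  functoriality, naturality and the triangles pass to the subcategory, where invertibility of both
  units turns the adjunction into a dual equivalence.\<close>

theorem theorem5p9:
  shows
  \<comment> \<open>\<open>StLCSob\<close> is a category\<close>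
  "(\<forall>X\<in>StLCSob :: 'a topology set. space_id X \<in> proper_maps X X) \<and>
   (\<forall>X\<in>StLCSob :: 'a topology set. \<forall>Y\<in>StLCSob :: 'b topology set. \<forall>Z\<in>StLCSob :: 'c topology set.
      \<forall>f\<in>proper_maps X Y. \<forall>g\<in>proper_maps Y Z. compose (topspace X) g f \<in> proper_maps X Z) \<and>
   (\<forall>X\<in>StLCSob :: 'a topology set. \<forall>Y\<in>StLCSob :: 'b topology set. \<forall>f\<in>proper_maps X Y.
      compose (topspace X) f (space_id X) = f \<and> compose (topspace X) (space_id Y) f = f) \<and>
   (\<forall>W\<in>StLCSob :: 'a topology set. \<forall>X\<in>StLCSob :: 'b topology set.
    \<forall>Y\<in>StLCSob :: 'c topology set. \<forall>Z\<in>StLCSob :: 'd topology set.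
      \<forall>f\<in>proper_maps W X. \<forall>g\<in>proper_maps X Y. \<forall>h\<in>proper_maps Y Z.
        compose (topspace W) h (compose (topspace W) g f) =
        compose (topspace W) (compose (topspace X) h g) f) \<and>

   \<comment> \<open>\<open>StLCMT\<close> is a category\<close>
   (\<forall>M\<in>StLCMT :: 'e mt set. mt_id M \<in> proper_mt_morphisms M M) \<and>
   (\<forall>M\<in>StLCMT :: 'e mt set. \<forall>N\<in>StLCMT :: 'f mt set. \<forall>R\<in>StLCMT :: 'g mt set.
      \<forall>f\<in>proper_mt_morphisms M N. \<forall>g\<in>proper_mt_morphisms N R.
        compose (carrier M) g f \<in> proper_mt_morphisms M R) \<and>
   (\<forall>M\<in>StLCMT :: 'e mt set. \<forall>N\<in>StLCMT :: 'f mt set. \<forall>f\<in>proper_mt_morphisms M N.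
      compose (carrier M) f (mt_id M) = f \<and> compose (carrier M) (mt_id N) f = f) \<and>
   (\<forall>L\<in>StLCMT :: 'e mt set. \<forall>M\<in>StLCMT :: 'f mt set.
    \<forall>N\<in>StLCMT :: 'g mt set. \<forall>R\<in>StLCMT :: 'h mt set.
      \<forall>f\<in>proper_mt_morphisms L M. \<forall>g\<in>proper_mt_morphisms M N. \<forall>h\<in>proper_mt_morphisms N R.
        compose (carrier L) h (compose (carrier L) g f) =
        compose (carrier L) (compose (carrier M) h g) f) \<and>

   \<comment> \<open>\<open>Pw\<close> is a contravariant functor from \<open>StLCSob\<close> to \<open>StLCMT\<close>\<close>
   (\<forall>X\<in>StLCSob :: 'a topology set. Pw X \<in> StLCMT) \<and>
   (\<forall>X\<in>StLCSob :: 'a topology set. \<forall>Y\<in>StLCSob :: 'b topology set. \<forall>f\<in>proper_maps X Y.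
      Pw_map X Y f \<in> proper_mt_morphisms (Pw Y) (Pw X)) \<and>
   (\<forall>X\<in>StLCSob :: 'a topology set. Pw_map X X (space_id X) = mt_id (Pw X)) \<and>
   (\<forall>X\<in>StLCSob :: 'a topology set. \<forall>Y\<in>StLCSob :: 'b topology set. \<forall>Z\<in>StLCSob :: 'c topology set.
      \<forall>f\<in>proper_maps X Y. \<forall>g\<in>proper_maps Y Z.
        Pw_map X Z (compose (topspace X) g f) =
        compose (carrier (Pw Z)) (Pw_map X Y f) (Pw_map Y Z g)) \<and>

   \<comment> \<open>\<open>at\<close> is a contravariant functor from \<open>StLCMT\<close> to \<open>StLCSob\<close>\<close>
   (\<forall>M\<in>StLCMT :: 'e mt set. at_space M \<in> StLCSob) \<and>
   (\<forall>M\<in>StLCMT :: 'e mt set. \<forall>N\<in>StLCMT :: 'f mt set. \<forall>f\<in>proper_mt_morphisms M N.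
      at_map M N f \<in> proper_maps (at_space N) (at_space M)) \<and>
   (\<forall>M\<in>StLCMT :: 'e mt set. at_map M M (mt_id M) = space_id (at_space M)) \<and>
   (\<forall>M\<in>StLCMT :: 'e mt set. \<forall>N\<in>StLCMT :: 'f mt set. \<forall>R\<in>StLCMT :: 'g mt set.
      \<forall>f\<in>proper_mt_morphisms M N. \<forall>g\<in>proper_mt_morphisms N R.
        at_map M R (compose (carrier M) g f) =
        compose (topspace (at_space R)) (at_map M N f) (at_map N R g)) \<and>

   \<comment> \<open>\<open>\<epsilon>\<close> and \<open>\<eta>\<close> are natural transformations in \<open>StLCSob\<close> and \<open>StLCMT\<close>\<close>
   (\<forall>X\<in>StLCSob :: 'a topology set. \<epsilon> X \<in> proper_maps X (at_space (Pw X))) \<and>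
   (\<forall>X\<in>StLCSob :: 'a topology set. \<forall>Y\<in>StLCSob :: 'b topology set. \<forall>f\<in>proper_maps X Y.
      compose (topspace X) (at_map (Pw Y) (Pw X) (Pw_map X Y f)) (\<epsilon> X) =
      compose (topspace X) (\<epsilon> Y) f) \<and>
   (\<forall>M\<in>StLCMT :: 'e mt set. \<eta> M \<in> proper_mt_morphisms M (Pw (at_space M))) \<and>
   (\<forall>M\<in>StLCMT :: 'e mt set. \<forall>N\<in>StLCMT :: 'f mt set. \<forall>f\<in>proper_mt_morphisms M N.
      compose (carrier M) (Pw_map (at_space N) (at_space M) (at_map M N f)) (\<eta> M) =
      compose (carrier M) (\<eta> N) f) \<and>

   \<comment> \<open>the triangle identities of the dual adjunction\<close>
   (\<forall>X\<in>StLCSob :: 'a topology set.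
      compose (carrier (Pw X)) (Pw_map X (at_space (Pw X)) (\<epsilon> X)) (\<eta> (Pw X)) = mt_id (Pw X)) \<and>
   (\<forall>M\<in>StLCMT :: 'e mt set.
      compose (topspace (at_space M)) (at_map M (Pw (at_space M)) (\<eta> M)) (\<epsilon> (at_space M)) =
      space_id (at_space M)) \<and>

   \<comment> \<open>the restriction to \<open>StLCSMT\<close> is a dual equivalence: the units are isomorphisms\<close>
   (\<forall>X\<in>StLCSob :: 'a topology set. Pw X \<in> StLCSMT) \<and>
   (\<forall>M\<in>StLCSMT :: 'e mt set. at_space M \<in> StLCSob) \<and>
   (\<forall>X\<in>StLCSob :: 'a topology set. space_iso X (at_space (Pw X)) (\<epsilon> X)) \<and>
   (\<forall>M\<in>StLCSMT :: 'e mt set. mt_iso M (Pw (at_space M)) (\<eta> M))"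
proof (intro conjI ballI)
  fix X :: "'a topology" and Y :: "'b topology" and Z :: "'c topology" and f g
  assume "f \<in> proper_maps X Y" "g \<in> proper_maps Y Z"
  then show "compose (topspace X) g f \<in> proper_maps X Z"
    and "Pw_map X Z (compose (topspace X) g f) =
      compose (carrier (Pw Z)) (Pw_map X Y f) (Pw_map Y Z g)"
    by (rule compose_proper_maps, intro Pw_map_compose proper_mapsD)
next
  fix X :: "'a topology" and Y :: "'b topology" and f
  assume "f \<in> proper_maps X Y"
  then have f: "f \<in> topspace X \<rightarrow>\<^sub>E topspace Y" by (rule proper_mapsD)
  then show "compose (topspace X) f (space_id X) = f" "compose (topspace X) (space_id Y) f = f"
    by (simp_all only: space_id_def compose_restrict_id)
  from f show "compose (topspace X) (at_map (Pw Y) (Pw X) (Pw_map X Y f)) (\<epsilon> X) =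
      compose (topspace X) (\<epsilon> Y) f"
    by (rule epsilon_natural)
next
  fix W :: "'a topology" and X :: "'b topology" and Y :: "'c topology" and Z :: "'d topology"
    and f g h
  assume "f \<in> proper_maps W X" "g \<in> proper_maps X Y" "h \<in> proper_maps Y Z"
  then show "compose (topspace W) h (compose (topspace W) g f) =
      compose (topspace W) (compose (topspace X) h g) f"
    using proper_mapsD[of f W X] by (intro compose_assoc) auto
next
  fix M :: "'e mt" and N :: "'f mt" and R :: "'g mt" and f g
  assume M: "M \<in> StLCMT" and N: "N \<in> StLCMT" and R: "R \<in> StLCMT"
    and f: "f \<in> proper_mt_morphisms M N" and g: "g \<in> proper_mt_morphisms N R"
  note alg = StLCMT_D(1)[OF M] StLCMT_D(1)[OF N] StLCMT_D(1)[OF R]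
  show "compose (carrier M) g f \<in> proper_mt_morphisms M R"
    by (rule compose_proper_mt_morphisms[OF alg f g])
  show "at_map M R (compose (carrier M) g f) =
      compose (topspace (at_space R)) (at_map M N f) (at_map N R g)"
    unfolding mt_algebra.topspace_at_space[OF alg(3)]
    by (rule at_map_compose[OF alg proper_mt_morphismsD(1)[OF f] proper_mt_morphismsD(1)[OF g]])
next
  fix M :: "'e mt" and N :: "'f mt" and f
  assume M: "M \<in> StLCMT" and N: "N \<in> StLCMT" and f: "f \<in> proper_mt_morphisms M N"
  interpret mt_morphism M N f
    by (rule mt_morphismI[OF StLCMT_D(1)[OF M] StLCMT_D(1)[OF N] proper_mt_morphismsD(1)[OF f]])
  show "compose (carrier M) f (mt_id M) = f" "compose (carrier M) (mt_id N) f = f"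
    unfolding mt_id_def
    by (rule compose_restrict_id[OF proper_mt_morphismsD(2)[OF f]])+
  show "at_map M N f \<in> proper_maps (at_space N) (at_space M)"
    by (rule proper_at_map[OF StLCMT_D(2)[OF N] proper_mt_morphismsD(3)[OF f]])
  show "compose (carrier M) (Pw_map (at_space N) (at_space M) (at_map M N f)) (\<eta> M) =
      compose (carrier M) (\<eta> N) f"
    by (rule eta_natural)
next
  fix L :: "'e mt" and M :: "'f mt" and N :: "'g mt" and R :: "'h mt" and f g h
  assume "f \<in> proper_mt_morphisms L M" "g \<in> proper_mt_morphisms M N"
    "h \<in> proper_mt_morphisms N R"
  then show "compose (carrier L) h (compose (carrier L) g f) =
      compose (carrier L) (compose (carrier M) h g) f"
    using proper_mt_morphismsD(2)[of f L M] by (intro compose_assoc) auto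
next
  fix M :: "'e mt"
  assume "M \<in> StLCSMT"
  then have M: "M \<in> StLCMT" and sp: "spatial M" by (auto simp: StLCSMT_def)
  show "mt_iso M (Pw (at_space M)) (\<eta> M)"
    by (rule mt_algebra.eta_iso[OF StLCMT_D(1)[OF M] sp StLCMT_D(2)[OF M]])
  show "at_space M \<in> StLCSob" by (rule at_space_StLCSob[OF M])
next
  fix M :: "'e mt"
  assume M: "M \<in> StLCMT"
  interpret mt_algebra M by (rule StLCMT_D(1)[OF M])
  show "mt_id M \<in> proper_mt_morphisms M M" by (rule mt_id_proper)
  show "at_space M \<in> StLCSob" by (rule at_space_StLCSob[OF M])
  show "at_map M M (mt_id M) = space_id (at_space M)" by (rule at_map_mt_id)
  show "\<eta> M \<in> proper_mt_morphisms M (Pw (at_space M))"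
    by (rule eta_proper[OF StLCMT_D(2)[OF M]])
  show "compose (topspace (at_space M)) (at_map M (Pw (at_space M)) (\<eta> M)) (\<epsilon> (at_space M)) =
      space_id (at_space M)"
    by (rule triangle_at)
next
  fix X :: "'a topology"
  assume X: "X \<in> StLCSob"
  show S: "Pw X \<in> StLCSMT" by (rule Pw_StLCSMT[OF X])
  then show "Pw X \<in> StLCMT" by (simp add: StLCSMT_def)
  show "space_iso X (at_space (Pw X)) (\<epsilon> X)" by (rule epsilon_iso[OF StLCSob_sober[OF X]])
qed (rule space_id_proper Pw_map_proper Pw_map_space_id epsilon_proper triangle_Pw; assumption)+

end
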